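(* Let $X$ be a locally Lipschitz vector field on an open set $\Omega\subset\mathbb{R}^n$. If $f\in L^1_{\rm loc}(\Omega)$ and $u:\Omega\to\mathbb{R}$ is a compactly supported Lipschitz function on $\Omega$, then $$\lim_{t\to0}\int_\Omega\Delta^X_tf(x)\,u(x)\,dx=-\int_\Omega f(x)\,Xu(x)\,dx-\int_\Omega f(x)\,u(x)\operatorname{div}X(x)\,dx.$$
   Context: A vector field on $\Omega$ is a map $X=(a_1,\dots,a_n):\Omega\to\mathbb{R}^n$. If $X$ is locally Lipschitz, for $x\in\Omega$ let $t\mapsto\gamma^X_t(x)\in\Omega$, $t\in\Gamma^X_x$ (an open interval containing $0$), be the unique maximal solution of $\dot\gamma(t)=X(\gamma(t))$, $\gamma(0)=x$. Put $\Gamma^X=\bigcup_{x\in\Omega}\Gamma^X_x\times\{x\}$, an open subset of $\mathbb{R}\times\Omega$ containing $\{0\}\times\Omega$. The difference quotient is $\Delta^X_tf(x)=\frac{f(\gamma^X_t(x))-f(x)}{t}$ for $(t,x)\in\Gamma^X$, $t\neq0$; for $|t|$ small enough it is defined for all $x$ in the support of $u$, and the integrand on the left is understood to be $0$ off the support of $u$. The functions $Xu=\sum_ia_i\,\partial u/\partial x_i$ and $\operatorname{div}X=\sum_i\partial a_i/\partial x_i$ are defined almost everywhere by Rademacher's theorem. *)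

theory Defs
  imports "HOL-Analysis.Analysis"
begin

subsection \<open>The flow of a vector field\<close>

definition integral_curve ::
  "(real^'n) set \<Rightarrow> (real^'n \<Rightarrow> real^'n) \<Rightarrow> real^'n \<Rightarrow> real set \<Rightarrow> (real \<Rightarrow> real^'n) \<Rightarrow> bool" where
  "integral_curve \<Omega> X x I \<gamma> \<longleftrightarrow>
     open I \<and> is_interval I \<and> 0 \<in> I \<and> \<gamma> 0 = x \<and>
     (\<forall>t\<in>I. \<gamma> t \<in> \<Omega> \<and> (\<gamma> has_vector_derivative X (\<gamma> t)) (at t))"

text \<open>Only the values of \<open>\<gamma>\<close> on \<open>I\<close> matter: a curve is maximal if its restriction to \<open>I\<close>
  cannot be extended to a solution on a larger open interval.\<close>

definition maximal_integral_curve ::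
  "(real^'n) set \<Rightarrow> (real^'n \<Rightarrow> real^'n) \<Rightarrow> real^'n \<Rightarrow> real set \<Rightarrow> (real \<Rightarrow> real^'n) \<Rightarrow> bool" where
  "maximal_integral_curve \<Omega> X x I \<gamma> \<longleftrightarrow>
     integral_curve \<Omega> X x I \<gamma> \<and>
     (\<forall>J \<eta>. integral_curve \<Omega> X x J \<eta> \<and> I \<subseteq> J \<and> (\<forall>t\<in>I. \<eta> t = \<gamma> t) \<longrightarrow> J = I)"

text \<open>For \<open>X\<close> locally Lipschitz on the open set \<open>\<Omega>\<close> and \<open>x \<in> \<Omega>\<close> the maximal interval, and the
  values on it of the maximal solution, are unique, so the descriptions below are proper; the value
  of \<open>flow \<Omega> X t x\<close> is meaningful only for \<open>(t, x) \<in> flow_domain \<Omega> X\<close>.\<close>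

definition flow_interval ::
  "(real^'n) set \<Rightarrow> (real^'n \<Rightarrow> real^'n) \<Rightarrow> real^'n \<Rightarrow> real set" where
  "flow_interval \<Omega> X x = (THE I. \<exists>\<gamma>. maximal_integral_curve \<Omega> X x I \<gamma>)"

definition flow ::
  "(real^'n) set \<Rightarrow> (real^'n \<Rightarrow> real^'n) \<Rightarrow> real \<Rightarrow> real^'n \<Rightarrow> real^'n" where
  "flow \<Omega> X t x = (THE y. \<exists>I \<gamma>. maximal_integral_curve \<Omega> X x I \<gamma> \<and> t \<in> I \<and> \<gamma> t = y)"

definition flow_domain ::
  "(real^'n) set \<Rightarrow> (real^'n \<Rightarrow> real^'n) \<Rightarrow> (real \<times> (real^'n)) set" where
  "flow_domain \<Omega> X = (\<Union>x\<in>\<Omega>. flow_interval \<Omega> X x \<times> {x})"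

definition diff_quotient ::
  "(real^'n) set \<Rightarrow> (real^'n \<Rightarrow> real^'n) \<Rightarrow> real \<Rightarrow> (real^'n \<Rightarrow> real) \<Rightarrow> real^'n \<Rightarrow> real" where
  "diff_quotient \<Omega> X t f x = (f (flow \<Omega> X t x) - f x) / t"

subsection \<open>Differential expressions\<close>

text \<open>Where a partial derivative does not exist, \<^const>\<open>deriv\<close> yields an arbitrary value; for
  locally Lipschitz functions this happens only on a null set.\<close>

definition partial_deriv :: "'n \<Rightarrow> (real^'n \<Rightarrow> real) \<Rightarrow> real^'n \<Rightarrow> real" where
  "partial_deriv i g x = deriv (\<lambda>s. g (x + s *\<^sub>R axis i 1)) 0"

definition vf_apply :: "(real^'n \<Rightarrow> real^'n) \<Rightarrow> (real^'n \<Rightarrow> real) \<Rightarrow> real^'n \<Rightarrow> real" where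
  "vf_apply X u x = (\<Sum>i\<in>UNIV. X x $ i * partial_deriv i u x)"

definition divergence :: "(real^'n \<Rightarrow> real^'n) \<Rightarrow> real^'n \<Rightarrow> real" where
  "divergence X x = (\<Sum>i\<in>UNIV. partial_deriv i (\<lambda>y. X y $ i) x)"

subsection \<open>Function classes\<close>

definition locally_integrable_on :: "(real^'n \<Rightarrow> real) \<Rightarrow> (real^'n) set \<Rightarrow> bool" where
  "locally_integrable_on f \<Omega> \<longleftrightarrow> (\<forall>K. compact K \<and> K \<subseteq> \<Omega> \<longrightarrow> f absolutely_integrable_on K)"

definition locally_lipschitz_field :: "(real^'n) set \<Rightarrow> (real^'n \<Rightarrow> real^'n) \<Rightarrow> bool" where
  "locally_lipschitz_field \<Omega> X \<longleftrightarrow> local_lipschitz (UNIV :: real set) \<Omega> (\<lambda>_. X)"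

text \<open>The support of a function on \<open>\<Omega>\<close> is the closure, relative to \<open>\<Omega>\<close>, of its nonzero set.\<close>

definition supp_in :: "(real^'n) set \<Rightarrow> (real^'n \<Rightarrow> real) \<Rightarrow> (real^'n) set" where
  "supp_in \<Omega> u = \<Omega> \<inter> closure {x\<in>\<Omega>. u x \<noteq> 0}"

end

theory Submission
  imports Defs
begin

text \<open>
  Let \<open>\<phi> t\<close> be the flow of \<open>X\<close>; a cutoff of \<open>X\<close> near the support of \<open>u\<close> reduces the claim to bounded
  fields on \<open>\<real>\<^sup>n\<close> with a global Lipschitz constant \<open>L\<close>. Then \<open>\<phi> t\<close> and its inverse are
  \<open>exp (L \<bar>t\<bar>)\<close>-Lipschitz, hence by Vitali's covering theorem \<open>\<phi> t\<close> distorts Lebesgue measure by a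
  factor \<open>1 + O(t)\<close>; no Jacobian is needed. Substituting \<open>y = \<phi> t x\<close> moves the difference quotient
  onto \<open>u\<close>, so its integral is bounded by a multiple of the \<open>L\<^sup>1\<close> norm of \<open>f\<close>, uniformly in small
  \<open>t\<close>, and it suffices to treat the dense class of polynomials \<open>p\<close>. For these the limit is
  \<open>\<integral> (X p) u\<close> by dominated convergence, and one integrates by parts: \<open>w = p a\<^sub>i u\<close> is Lipschitz with
  compact support, and the integral of \<open>\<partial>\<^sub>i w\<close> vanishes since that of every difference quotient of \<open>w\<close>
  does. Only partial derivatives almost everywhere are used, that is, Rademacher's theorem in
  dimension one, a second application of the comparison of measures on small balls.
\<close>

subsection \<open>Comparison of measures on balls\<close>

text \<open>The obstacle is that \<open>u\<close> and \<open>X\<close> are handled only through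
  derivatives in coordinate directions. Differentiating \<open>u\<close> along an orbit would call
  for total differentiability. So moving the flow onto \<open>u\<close> serves only to get a bound,
  for which the Lipschitz constant of \<open>u\<close> is enough; the limit itself is computed with
  the derivative on a smooth function and then returned to \<open>u\<close> and \<open>X\<close> one
  coordinate at a time. A Lipschitz bound controls measure from one side only, so it is applied both
  to \<open>\<phi> t\<close> and to \<open>\<phi> (- t)\<close>. Both factors are
  \<open>exp (DIM('a) * L * \<bar>t\<bar>)\<close>, and division by \<open>t\<close> turns their
  linear deviation from 1 into a constant. Finally, \<open>f\<close> is Lebesgue measurable and
  given up to null sets. Near the support it is replaced by an integrable Borel function
  \<open>g\<close>, and composing \<open>g\<close> with the flow is legitimate because preimages of
  null sets are null, again by the comparison of measures.\<close>

text \<open>Vitali's theorem selects disjoint admissible balls that cover \<open>A\<close> up to a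
  null set, and the inequalities on balls add up. What the balls cover besides \<open>A\<close> lies
  in an open set \<open>G\<close> close to \<open>A\<close> and costs at most \<open>C\<close> times
  the measure of \<open>G - A\<close>. The balls contain \<open>x\<close> but need not be centred
  there: the intervals used for difference quotients have \<open>x\<close> as an endpoint.\<close>

lemma emeasure_le_by_small_cballs:
  fixes M N :: "'a::euclidean_space measure"
  assumes setsM: "sets M = sets borel" and setsN: "sets N = sets borel"
    and M: "\<And>Z. Z \<in> null_sets lborel \<Longrightarrow> emeasure M Z = 0"
    and N: "\<And>A. A \<in> sets borel \<Longrightarrow> emeasure N A \<le> ennreal C * emeasure lborel A"
    and A: "A \<in> sets borel"
    and balls: "\<And>x d. x \<in> A \<Longrightarrow> 0 < d \<Longrightarrow> \<exists>a r. 0 < r \<and> r < d \<and> x \<in> cball a r \<and>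
      emeasure M (cball a r) \<le> emeasure N (cball a r)"
  shows "emeasure M A \<le> emeasure N A"
proof (rule ennreal_le_epsilon)
  fix e :: real
  assume e: "0 < e"
  \<comment> \<open>\<open>ennreal C\<close> is 0 for negative \<open>C\<close>, hence
    \<open>max C 0\<close>; the added 1 keeps the denominator positive.\<close>
  define \<delta> where "\<delta> = e / (max C 0 + 1)"
  have \<delta>: "\<delta> > 0" using e by (simp add: \<delta>_def add_nonneg_pos)
  have "A \<in> sets lebesgue" using A by auto
  then obtain G where G: "open G" "A \<subseteq> G" "emeasure lebesgue (G - A) < ennreal \<delta>"
    using sets_lebesgue_outer_open[OF _ \<delta>] by metis
  have GA: "G - A \<in> sets borel" using G A by auto
  define K where "K = {(a, r). 0 < r \<and> cball a r \<subseteq> G \<and> emeasure M (cball a r) \<le> emeasure N (cball a r)}"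
  obtain D where D: "countable D" "D \<subseteq> K"
     "pairwise (\<lambda>i j. disjnt (cball (fst i) (snd i)) (cball (fst j) (snd j))) D"
     "negligible (A - (\<Union>i \<in> D. cball (fst i) (snd i)))"
  proof (rule Vitali_covering_theorem_cballs[of K snd A fst])
    show "0 < snd i" if "i \<in> K" for i using that by (auto simp: K_def)
    fix x and d :: real
    assume x: "x \<in> A" and d: "0 < d"
    obtain s where s: "s > 0" "ball x s \<subseteq> G"
      using G x openE by blast
    \<comment> \<open>A ball of radius \<open>r\<close> containing \<open>x\<close> lies within
      distance \<open>2 * r\<close> of \<open>x\<close>, so \<open>r < s/2\<close> keeps it inside
      \<open>G\<close>.\<close>
    obtain a r where ar: "0 < r" "r < min d (s/2)" "x \<in> cball a r"
      "emeasure M (cball a r) \<le> emeasure N (cball a r)"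
      using balls[OF x, of "min d (s/2)"] s d by auto
    have "cball a r \<subseteq> ball x s"
    proof
      fix y assume "y \<in> cball a r"
      then have "dist x y \<le> 2 * r"
        using ar(3) dist_triangle[of x y a] by (auto simp: dist_commute)
      then show "y \<in> ball x s" using ar by auto
    qed
    then have "(a, r) \<in> K" using ar s by (auto simp: K_def)
    then show "\<exists>i. i \<in> K \<and> x \<in> cball (fst i) (snd i) \<and> snd i < d"
      using ar by (intro exI[of _ "(a, r)"]) auto
  qed
  define B where "B i = cball (fst i) (snd i)" for i :: "'a \<times> real"
  have Bm: "B i \<in> sets borel" for i by (simp add: B_def)
  have disj: "disjoint_family_on B D"
    using D(3) by (auto simp: disjoint_family_on_def pairwise_def disjnt_def B_def)
  have U: "(\<Union>i\<in>D. B i) \<in> sets borel"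
    using D(1) Bm by (intro sets.countable_UN') auto
  have null: "A - (\<Union>i\<in>D. B i) \<in> null_sets lborel"
    using D(4) A U by (auto simp: negligible_iff_null_sets B_def null_sets_completion_iff)
  have "emeasure M A \<le> emeasure M ((A - (\<Union>i\<in>D. B i)) \<union> (\<Union>i\<in>D. B i))"
    using A U setsM by (intro emeasure_mono) auto
  also have "\<dots> \<le> emeasure M (A - (\<Union>i\<in>D. B i)) + emeasure M (\<Union>i\<in>D. B i)"
    using A U setsM by (intro emeasure_subadditive) auto
  also have "\<dots> = emeasure M (\<Union>i\<in>D. B i)" using M[OF null] by simp
  also have "\<dots> = (\<integral>\<^sup>+i. emeasure M (B i) \<partial>count_space D)"
    using Bm setsM D(1) disj by (intro emeasure_UN_countable) auto
  also have "\<dots> \<le> (\<integral>\<^sup>+i. emeasure N (B i) \<partial>count_space D)"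
    using D(2) by (intro nn_integral_mono) (auto simp: K_def B_def)
  also have "\<dots> = emeasure N (\<Union>i\<in>D. B i)"
    using Bm setsN D(1) disj by (intro emeasure_UN_countable[symmetric]) auto
  also have "\<dots> \<le> emeasure N (A \<union> (G - A))"
  proof (rule emeasure_mono)
    have "B i \<subseteq> G" if "i \<in> D" for i
      using subsetD[OF D(2) that] unfolding K_def B_def by (cases i) simp
    then show "(\<Union>i\<in>D. B i) \<subseteq> A \<union> (G - A)" by blast
    show "A \<union> (G - A) \<in> sets N" unfolding setsN using A GA by (rule sets.Un)
  qed
  also have "\<dots> \<le> emeasure N A + emeasure N (G - A)"
    using A GA setsN by (intro emeasure_subadditive) auto
  also have "emeasure N (G - A) \<le> ennreal C * emeasure lborel (G - A)"
    using N GA by auto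
  also have "emeasure lborel (G - A) \<le> ennreal \<delta>"
    using G(3) GA by simp
  also have "ennreal C * ennreal \<delta> \<le> ennreal e"
  proof -
    have "max C 0 * \<delta> \<le> e"
      using e by (simp add: \<delta>_def divide_simps)
    then show ?thesis
      by (smt (verit) ennreal_leI ennreal_mult' ennreal_neg \<delta> max_def mult_zero_left zero_le)
  qed
  finally show "emeasure M A \<le> emeasure N A + ennreal e"
    by (simp add: add_left_mono mult_left_mono)
qed

lemma emeasure_cball_scale:
  fixes a b :: "'a::euclidean_space"
  assumes "0 \<le> r" "0 \<le> B"
  shows "emeasure lborel (cball (b::'a) (B * r)) = ennreal (B ^ DIM('a)) * emeasure lborel (cball a r)"
  using assms by (simp add: emeasure_cball ennreal_mult'[symmetric] power_mult_distrib mult_ac)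

text \<open>The preimage under \<open>\<phi>\<close> of a ball of radius \<open>r\<close> is its
  image under \<open>\<psi>\<close> and lies in a ball of radius \<open>B * r\<close>, whose volume
  is \<open>B ^ DIM('a)\<close> times as large. The covering lemma passes from balls to Borel sets,
  since Lipschitz images of null sets are null.\<close>

lemma emeasure_distr_le_lipschitz:
  fixes \<phi> \<psi> :: "'a::euclidean_space \<Rightarrow> 'a"
  assumes \<phi>: "continuous_on UNIV \<phi>" and \<psi>: "B-lipschitz_on UNIV \<psi>"
    and inv: "\<And>x. \<phi> (\<psi> x) = x" "\<And>x. \<psi> (\<phi> x) = x"
    and A: "A \<in> sets borel"
  shows "emeasure (distr lborel borel \<phi>) A \<le> ennreal (B ^ DIM('a)) * emeasure lborel A"
proof -
  have B: "0 \<le> B" using \<psi> lipschitz_on_nonneg by blast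
  have [measurable]: "\<phi> \<in> borel_measurable borel" using \<phi> by (rule borel_measurable_continuous_onI)
  have [measurable]: "\<psi> \<in> borel_measurable borel"
    using lipschitz_on_continuous_on[OF \<psi>] by (rule borel_measurable_continuous_onI)
  have vim: "\<phi> -` S = \<psi> ` S" for S using inv by (auto simp: image_iff) metis
  let ?N = "scale_measure (ennreal (B ^ DIM('a))) lborel"
  have "emeasure (distr lborel borel \<phi>) A \<le> emeasure ?N A"
  proof (rule emeasure_le_by_small_cballs[OF _ _ _ _ A, where C = "B ^ DIM('a)"])
    fix Z :: "'a set"
    assume Z: "Z \<in> null_sets lborel"
    then have "negligible Z" by (auto simp: negligible_iff_null_sets null_sets_completionI)
    then have "negligible (\<psi> ` Z)"
    proof (rule negligible_locally_Lipschitz_image[rotated])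
      show "\<exists>T B. open T \<and> x \<in> T \<and> (\<forall>y\<in>Z \<inter> T. norm (\<psi> y - \<psi> x) \<le> B * norm (y - x))" for x
        using lipschitz_on_normD[OF \<psi>] by (intro exI[of _ UNIV] exI[of _ B]) auto
    qed simp
    moreover have "\<psi> ` Z \<in> sets borel"
      using Z vim[of Z] measurable_sets[of \<phi> borel borel Z] by auto
    ultimately show "emeasure (distr lborel borel \<phi>) Z = 0"
      using Z by (auto simp: emeasure_distr vim negligible_iff_null_sets null_sets_completion_iff null_setsD1 null_setsD2)
  next
    fix x :: 'a and d :: real
    assume d: "0 < d"
    have sub: "\<psi> ` cball x (d/2) \<subseteq> cball (\<psi> x) (B * (d/2))"
    proof
      fix y assume "y \<in> \<psi> ` cball x (d/2)"
      then obtain z where z: "z \<in> cball x (d/2)" "y = \<psi> z" by auto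
      have "dist (\<psi> x) y \<le> B * dist x z" using \<psi> z by (auto simp: lipschitz_on_def)
      also have "\<dots> \<le> B * (d/2)" using z B by (intro mult_left_mono) auto
      finally show "y \<in> cball (\<psi> x) (B * (d/2))" by simp
    qed
    have "emeasure (distr lborel borel \<phi>) (cball x (d/2)) \<le> emeasure lborel (cball (\<psi> x) (B * (d/2)))"
      using sub by (auto simp: emeasure_distr vim intro!: emeasure_mono)
    also have "\<dots> = emeasure ?N (cball x (d/2))"
      using d B by (subst emeasure_cball_scale[of _ _ _ x]) auto
    finally show "\<exists>a r. 0 < r \<and> r < d \<and> x \<in> cball a r \<and>
        emeasure (distr lborel borel \<phi>) (cball a r) \<le> emeasure ?N (cball a r)"
      using d by (intro exI[of _ x] exI[of _ "d/2"]) auto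
  qed auto
  then show ?thesis by simp
qed

subsection \<open>Partial derivatives of Lipschitz functions\<close>

text \<open>Up to the cases of equality, these are the points where the lower derivative in
  direction \<open>e\<close> is below \<open>p\<close> and the upper one above \<open>q\<close>. A
  bounded quotient fails to converge exactly if this happens for some rational
  \<open>p < q\<close>.\<close>

definition oscillation_set :: "('a::real_normed_vector \<Rightarrow> real) \<Rightarrow> 'a \<Rightarrow> real \<Rightarrow> real \<Rightarrow> 'a set" where
  "oscillation_set w e p q = {x. \<forall>d>0.
     (\<exists>h. h \<noteq> 0 \<and> \<bar>h\<bar> < d \<and> (w (x + h *\<^sub>R e) - w x) / h < p) \<and>
     (\<exists>h. h \<noteq> 0 \<and> \<bar>h\<bar> < d \<and> q < (w (x + h *\<^sub>R e) - w x) / h)}"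

text \<open>For fixed \<open>h\<close> each inequality is an open condition on \<open>x\<close>, and
  the union over all small \<open>h\<close> remains open. So only \<open>d\<close> has to be made
  countable, by means of \<open>1 / Suc n\<close>.\<close>

lemma borel_oscillation_set:
  fixes w :: "'a::euclidean_space \<Rightarrow> real"
  assumes w: "continuous_on UNIV w"
  shows "oscillation_set w e p q \<in> sets borel"
proof -
  define P where "P n = (\<Union>h\<in>{h. h \<noteq> 0 \<and> \<bar>h\<bar> < 1 / Suc n}. {x. (w (x + h *\<^sub>R e) - w x) / h < p})" for n :: nat
  define Q where "Q n = (\<Union>h\<in>{h. h \<noteq> 0 \<and> \<bar>h\<bar> < 1 / Suc n}. {x. q < (w (x + h *\<^sub>R e) - w x) / h})" for n :: nat
  have cont: "continuous_on UNIV (\<lambda>x. (w (x + h *\<^sub>R e) - w x) / h)" if "h \<noteq> 0" for h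
    using that by (intro continuous_intros continuous_on_compose2[OF w]) auto
  have "open (P n)" "open (Q n)" for n
    unfolding P_def Q_def using cont by (auto intro!: open_UN open_Collect_less)
  then have "(\<Inter>n. P n \<inter> Q n) \<in> sets borel" by auto
  moreover have "oscillation_set w e p q = (\<Inter>n. P n \<inter> Q n)"
  proof (intro equalityI subsetI)
    fix x assume x: "x \<in> oscillation_set w e p q"
    have "x \<in> P n \<inter> Q n" for n
      using x unfolding oscillation_set_def P_def Q_def
      by simp
    then show "x \<in> (\<Inter>n. P n \<inter> Q n)" by blast
  next
    fix x assume x: "x \<in> (\<Inter>n. P n \<inter> Q n)"
    show "x \<in> oscillation_set w e p q"
      unfolding oscillation_set_def
    proof (intro CollectI allI impI)
      fix d :: real assume "d > 0"
      then obtain n where n: "1 / Suc n < d" using nat_approx_posE by blast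
      have "x \<in> P n" "x \<in> Q n" using x by auto
      then show "(\<exists>h. h \<noteq> 0 \<and> \<bar>h\<bar> < d \<and> (w (x + h *\<^sub>R e) - w x) / h < p) \<and>
          (\<exists>h. h \<noteq> 0 \<and> \<bar>h\<bar> < d \<and> q < (w (x + h *\<^sub>R e) - w x) / h)"
        unfolding P_def Q_def using n by simp (metis order.strict_trans)
    qed
  qed
  ultimately show ?thesis by simp
qed

text \<open>The measure that the increasing homeomorphism \<open>x \<mapsto> w x + (L + 1) x\<close> induces has density
  at most \<open>p + L + 1\<close> and at least \<open>q + L + 1\<close> on the oscillation set.\<close>

lemma null_oscillation_set_real:
  fixes w :: "real \<Rightarrow> real"
  assumes w: "L-lipschitz_on UNIV w" and "p < q"
  shows "oscillation_set w 1 p q \<in> null_sets lborel"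
proof -
  \<comment> \<open>Adding \<open>(L + 1) * x\<close> to an \<open>L\<close>-Lipschitz function
    gives slopes between 1 and \<open>2 * L + 1\<close>, so \<open>g\<close> is an increasing
    homeomorphism of the line that is Lipschitz in both directions.\<close>
  define g where "g x = w x + (L + 1) * x" for x
  have L: "0 \<le> L" using w lipschitz_on_nonneg by blast
  have wd: "\<bar>w x - w y\<bar> \<le> L * \<bar>x - y\<bar>" for x y
    using lipschitz_on_normD[OF w] by (simp add: dist_real_def)
  have g_lower: "y - x \<le> g y - g x" if "x \<le> y" for x y
    using wd[of y x] that by (simp add: g_def algebra_simps abs_if split: if_splits)
  have g_lip: "(2 * L + 1)-lipschitz_on UNIV g"
  proof (rule lipschitz_onI)
    fix x y show "dist (g x) (g y) \<le> (2 * L + 1) * dist x y"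
      using wd[of x y] L by (simp add: g_def dist_real_def algebra_simps abs_if split: if_splits)
  qed (use L in simp)
  then have g_cont: "continuous_on UNIV g" by (rule lipschitz_on_continuous_on)
  have g_less: "g x < g y \<longleftrightarrow> x < y" for x y
  proof (cases "x < y")
    case True then show ?thesis using g_lower[of x y] by linarith
  next
    case False then show ?thesis using g_lower[of y x] by linarith
  qed
  have g_le: "g x \<le> g y \<longleftrightarrow> x \<le> y" for x y
    using g_less[of y x] by (auto simp: not_less[symmetric])
  have "inj g"
  proof (rule injI)
    fix x y assume "g x = g y"
    then show "x = y" using g_less[of x y] g_less[of y x] by auto
  qed
  have "surj g"
  proof (rule surjI)
    fix y
    \<comment> \<open>Slopes of at least 1 place the values of \<open>g\<close> at
      \<open>- r\<close> and \<open>r\<close> at least \<open>r\<close> below and above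
      \<open>g 0\<close>, so they enclose \<open>y\<close>.\<close>
    define r where "r = \<bar>y - g 0\<bar>"
    have "g (- r) \<le> y" "y \<le> g r" using g_lower[of 0 r] g_lower[of "-r" 0] by (auto simp: r_def)
    then have "\<exists>x. - r \<le> x \<and> x \<le> r \<and> g x = y"
      using continuous_on_subset[OF g_cont subset_UNIV] by (intro IVT') (simp_all add: r_def)
    then show "g (SOME x. g x = y) = y" by (metis (mono_tags) someI_ex)
  qed
  define k where "k = inv g"
  have gk: "g (k x) = x" and kg: "k (g x) = x" for x
    using \<open>inj g\<close> \<open>surj g\<close> by (auto simp: k_def surj_f_inv_f)
  have k_cont: "continuous_on UNIV k"
  proof -
    have "\<bar>k x - k y\<bar> \<le> \<bar>x - y\<bar>" for x y
    proof (cases "k x \<le> k y")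
      case True then show ?thesis using g_lower[of "k x" "k y"] by (simp add: gk)
    next
      case False then show ?thesis using g_lower[of "k y" "k x"] by (simp add: gk)
    qed
    then have "1-lipschitz_on UNIV k" by (auto simp: lipschitz_on_def dist_real_def)
    then show ?thesis by (rule lipschitz_on_continuous_on)
  qed
  then have [measurable]: "k \<in> borel_measurable borel" by (rule borel_measurable_continuous_onI)
  \<comment> \<open>As \<open>k\<close> is the inverse of \<open>g\<close>, this is the Stieltjes
    measure of \<open>g\<close>: a set is measured by the length of its image under
    \<open>g\<close>.\<close>
  define \<mu> where "\<mu> = distr lborel borel k"
  have [simp]: "sets \<mu> = sets borel" by (simp add: \<mu>_def)
  have \<mu>_le: "emeasure \<mu> A \<le> ennreal (2 * L + 1) * emeasure lborel A" if "A \<in> sets borel" for A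
    using emeasure_distr_le_lipschitz[OF k_cont g_lip kg gk that] by (simp add: \<mu>_def)
  have \<mu>_null: "emeasure \<mu> Z = 0" if "Z \<in> null_sets lborel" for Z
    using \<mu>_le[of Z] that by (auto simp: null_sets_def)
  have kv: "k -` S = g ` S" for S using gk kg by (auto simp: image_iff) metis
  have \<mu>_Icc: "emeasure \<mu> {a..b} = ennreal (g b - g a)" if "a \<le> b" for a b
  proof -
    have "k -` {a..b} = {g a..g b}"
      using g_le gk kg by (auto simp: vimage_def) (metis g_le)+
    then show ?thesis using that g_le by (simp add: \<mu>_def emeasure_distr)
  qed
  \<comment> \<open>The segment between \<open>x\<close> and \<open>x + h\<close> is a closed ball
    about its midpoint with \<open>x\<close> on the boundary, whatever the sign of \<open>h\<close>.
    Its \<open>\<mu>\<close>-measure per unit length is the difference quotient of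
    \<open>g\<close>.\<close>
  have interval: "\<exists>a r. 0 < r \<and> r < d \<and> x \<in> cball a r \<and>
      emeasure \<mu> (cball a r) = ennreal ((w (x + h) - w x) / h + L + 1) * ennreal (2 * r) \<and>
      emeasure lborel (cball a r) = ennreal (2 * r)"
    if h: "h \<noteq> 0" "\<bar>h\<bar> < d" for x h d :: real
  proof (intro exI conjI)
    have cb: "cball (x + h/2) (\<bar>h\<bar>/2) = {min x (x + h)..max x (x + h)}"
      by (auto simp: cball_eq_atLeastAtMost min_def max_def abs_if)
    have "emeasure \<mu> (cball (x + h/2) (\<bar>h\<bar>/2)) = ennreal (g (max x (x + h)) - g (min x (x + h)))"
      unfolding cb by (rule \<mu>_Icc) simp
    also have "g (max x (x + h)) - g (min x (x + h)) = ((w (x + h) - w x) / h + L + 1) * \<bar>h\<bar>"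
      using h by (auto simp: g_def min_def max_def abs_if field_simps)
    also have "ennreal \<dots> = ennreal ((w (x + h) - w x) / h + L + 1) * ennreal (2 * (\<bar>h\<bar>/2))"
      by (subst ennreal_mult'') auto
    finally show "emeasure \<mu> (cball (x + h/2) (\<bar>h\<bar>/2)) =
       ennreal ((w (x + h) - w x) / h + L + 1) * ennreal (2 * (\<bar>h\<bar>/2))" .
    show "emeasure lborel (cball (x + h/2) (\<bar>h\<bar>/2)) = ennreal (2 * (\<bar>h\<bar>/2))"
      unfolding cb by (subst emeasure_lborel_Icc) (auto simp: min_def max_def abs_if)
    show "x \<in> cball (x + h/2) (\<bar>h\<bar>/2)" by (auto simp: dist_real_def)
  qed (use h in auto)
  define E where "E = oscillation_set w 1 p q"
  have E: "E \<in> sets borel" unfolding E_def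
    by (rule borel_oscillation_set[OF lipschitz_on_continuous_on[OF w]])
  \<comment> \<open>Truncation makes the measure finite, so that it can be cancelled when the two
    density bounds are compared.\<close>
  have "emeasure lborel (E \<inter> {-real n..real n}) = 0" for n
  proof -
    define A where "A = E \<inter> {-real n..real n}"
    have A: "A \<in> sets borel" using E by (simp add: A_def)
    have upper: "emeasure \<mu> A \<le> emeasure (scale_measure (ennreal (p + L + 1)) lborel) A"
    proof (rule emeasure_le_by_small_cballs[OF _ _ \<mu>_null _ A, where C = "p + L + 1"])
      fix x d :: real assume "x \<in> A" "0 < d"
      then obtain h where h: "h \<noteq> 0" "\<bar>h\<bar> < d" "(w (x + h) - w x) / h < p"
        unfolding A_def E_def oscillation_set_def by auto
      from interval[OF h(1,2), of x] obtain a r where ar: "0 < r" "r < d" "x \<in> cball a r"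
        "emeasure \<mu> (cball a r) = ennreal ((w (x + h) - w x) / h + L + 1) * ennreal (2 * r)"
        "emeasure lborel (cball a r) = ennreal (2 * r)" by auto
      show "\<exists>a r. 0 < r \<and> r < d \<and> x \<in> cball a r \<and> emeasure \<mu> (cball a r) \<le>
          emeasure (scale_measure (ennreal (p + L + 1)) lborel) (cball a r)"
        using ar h by (intro exI[of _ a] exI[of _ r]) (auto intro!: mult_right_mono ennreal_leI)
    qed auto
    have lower: "emeasure (scale_measure (ennreal (q + L + 1)) lborel) A \<le> emeasure \<mu> A"
    proof (rule emeasure_le_by_small_cballs[OF _ _ _ \<mu>_le A])
      fix x d :: real assume "x \<in> A" "0 < d"
      then obtain h where h: "h \<noteq> 0" "\<bar>h\<bar> < d" "(w (x + h) - w x) / h > q"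
        unfolding A_def E_def oscillation_set_def by auto
      from interval[OF h(1,2), of x] obtain a r where ar: "0 < r" "r < d" "x \<in> cball a r"
        "emeasure \<mu> (cball a r) = ennreal ((w (x + h) - w x) / h + L + 1) * ennreal (2 * r)"
        "emeasure lborel (cball a r) = ennreal (2 * r)" by auto
      show "\<exists>a r. 0 < r \<and> r < d \<and> x \<in> cball a r \<and>
          emeasure (scale_measure (ennreal (q + L + 1)) lborel) (cball a r) \<le> emeasure \<mu> (cball a r)"
        using ar h by (intro exI[of _ a] exI[of _ r]) (auto intro!: mult_right_mono ennreal_leI)
    qed (auto simp: null_sets_def)
    have "emeasure lborel A \<le> emeasure lborel {-real n..real n}"
      by (rule emeasure_mono) (auto simp: A_def)
    then have "emeasure lborel A < \<infinity>" by (rule le_less_trans) simp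
    then obtain m where m: "emeasure lborel A = ennreal m" "0 \<le> m"
      by (metis ennreal_cases infinity_ennreal_def less_irrefl)
    show ?thesis
    proof (cases "A = {}")
      case False
      then obtain x where "x \<in> A" by auto
      then obtain h where h: "h \<noteq> 0" "(w (x + h) - w x) / h < p"
        unfolding A_def E_def oscillation_set_def by (auto intro: zero_less_one)
      have "- L \<le> (w (x + h) - w x) / h"
        using wd[of "x + h" x] h(1) by (auto simp: divide_simps abs_if split: if_splits)
      \<comment> \<open>Positivity is read off from a quotient at a point of \<open>A\<close>, which
        explains the case distinction; it ensures that \<open>ennreal\<close> does not truncate the
        factor.\<close>
      then have "0 < p + L + 1" using h by linarith
      moreover have "ennreal (q + L + 1) * ennreal m \<le> ennreal (p + L + 1) * ennreal m"
        using upper lower m by simp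
      ultimately have "(q + L + 1) * m \<le> (p + L + 1) * m"
        using m(2) \<open>p < q\<close> by (simp add: ennreal_mult'[symmetric])
      then have "m = 0" using m(2) \<open>p < q\<close> by (simp add: mult_le_cancel_right)
      then show ?thesis using m by (simp add: A_def)
    qed (simp add: A_def)
  qed
  then have "(\<Union>n. E \<inter> {-real n..real n}) \<in> null_sets lborel"
    using E by (intro null_sets_UN) (auto simp: null_sets_def)
  moreover have "(\<Union>n. E \<inter> {-real n..real n}) = E"
  proof -
    have "\<exists>n. - real n \<le> x \<and> x \<le> real n" for x :: real
      using real_arch_simple[of "\<bar>x\<bar>"] by (auto simp: abs_le_iff) (metis minus_le_iff)
    then show ?thesis by fastforce
  qed
  ultimately show ?thesis by (simp add: E_def)
qed

text \<open>Integrating the indicator over \<open>(s, x) \<in> [0, 1] \<times> \<real>\<^sup>n\<close> at \<open>x + s e\<close> and exchanging the order of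
  integration avoids splitting off a coordinate.\<close>

lemma null_set_of_null_lines:
  fixes N :: "'a::euclidean_space set"
  assumes N: "N \<in> sets borel"
    and lines: "\<And>x. {s::real. x + s *\<^sub>R e \<in> N} \<in> null_sets lborel"
  shows "N \<in> null_sets lborel"
proof -
  define F :: "real \<Rightarrow> 'a \<Rightarrow> ennreal" where "F s x = indicator {0..1} s * indicator N (x + s *\<^sub>R e)" for s x
  have [measurable]: "N \<in> sets borel" by fact
  have F: "case_prod F \<in> borel_measurable (lborel \<Otimes>\<^sub>M lborel)"
    unfolding F_def by measurable
  have "(\<integral>\<^sup>+x. F s x \<partial>lborel) = indicator {0..1} s * emeasure lborel N" for s
  proof -
    have "(\<integral>\<^sup>+x. F s x \<partial>lborel) = indicator {0..1} s * (\<integral>\<^sup>+x. indicator N (s *\<^sub>R e + x) \<partial>lborel)"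
      unfolding F_def by (subst nn_integral_cmult) (auto simp: add.commute)
    also have "(\<integral>\<^sup>+x. indicator N (s *\<^sub>R e + x) \<partial>lborel) = (\<integral>\<^sup>+x. indicator N x \<partial>(distr lborel borel ((+) (s *\<^sub>R e))))"
      by (subst nn_integral_distr) auto
    also have "\<dots> = emeasure lborel N"
      unfolding lborel_distr_plus by simp
    finally show ?thesis .
  qed
  then have "(\<integral>\<^sup>+s. \<integral>\<^sup>+x. F s x \<partial>lborel \<partial>lborel) = emeasure lborel N"
    by (simp add: nn_integral_multc)
  moreover have "(\<integral>\<^sup>+s. \<integral>\<^sup>+x. F s x \<partial>lborel \<partial>lborel) = (\<integral>\<^sup>+x. \<integral>\<^sup>+s. F s x \<partial>lborel \<partial>lborel)"
    by (rule lborel_pair.Fubini'[OF F, symmetric])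
  moreover have "(\<integral>\<^sup>+s. F s x \<partial>lborel) = 0" for x
  proof -
    have "AE s in lborel. s \<notin> {s. x + s *\<^sub>R e \<in> N}" using lines by (rule AE_not_in)
    then have "(\<integral>\<^sup>+s. F s x \<partial>lborel) = (\<integral>\<^sup>+(s::real). 0 \<partial>lborel)"
      by (intro nn_integral_cong_AE) (auto simp: F_def)
    then show ?thesis by simp
  qed
  ultimately show ?thesis using N by (auto simp: null_sets_def)
qed

text \<open>Along a line in direction \<open>e\<close> the set becomes the oscillation set of the
  restriction of \<open>w\<close>, a Lipschitz function of one variable.\<close>

lemma null_oscillation_set:
  fixes w :: "'a::euclidean_space \<Rightarrow> real"
  assumes w: "L-lipschitz_on UNIV w" and pq: "p < q"
  shows "oscillation_set w e p q \<in> null_sets lborel"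
proof (rule null_set_of_null_lines)
  show "oscillation_set w e p q \<in> sets borel"
    by (rule borel_oscillation_set[OF lipschitz_on_continuous_on[OF w]])
  fix x
  have "(L * norm e)-lipschitz_on UNIV (\<lambda>s. w (x + s *\<^sub>R e))"
  proof (rule lipschitz_onI)
    fix s t :: real
    have "dist (w (x + s *\<^sub>R e)) (w (x + t *\<^sub>R e)) \<le> L * dist (x + s *\<^sub>R e) (x + t *\<^sub>R e)"
      using w by (rule lipschitz_onD) auto
    also have "dist (x + s *\<^sub>R e) (x + t *\<^sub>R e) = norm e * dist s t"
      by (simp add: dist_norm scaleR_left_diff_distrib[symmetric])
    finally show "dist (w (x + s *\<^sub>R e)) (w (x + t *\<^sub>R e)) \<le> L * norm e * dist s t" by simp
  qed (use lipschitz_on_nonneg[OF w] in simp)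
  from null_oscillation_set_real[OF this pq]
  show "{s. x + s *\<^sub>R e \<in> oscillation_set w e p q} \<in> null_sets lborel"
    by (simp add: oscillation_set_def algebra_simps)
qed

lemma lipschitz_difference_quotient_le:
  fixes w :: "'a::real_normed_vector \<Rightarrow> real"
  assumes w: "L-lipschitz_on UNIV w" and h: "h \<noteq> 0"
  shows "\<bar>(w (x + h *\<^sub>R e) - w x) / h\<bar> \<le> L * norm e"
  using lipschitz_on_normD[OF w, of "x + h *\<^sub>R e" x] h by (simp add: divide_simps mult_ac)

text \<open>Rationals strictly between the limit inferior and the limit superior would exhibit an
  oscillation, so the two agree in the extended reals; the bound makes the common value
  finite.\<close>

lemma convergent_of_no_oscillation:
  fixes Q :: "'a \<Rightarrow> real"
  assumes F: "F \<noteq> bot" and bdd: "eventually (\<lambda>h. \<bar>Q h\<bar> \<le> B) F"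
    and osc: "\<And>p q. p \<in> \<rat> \<Longrightarrow> q \<in> \<rat> \<Longrightarrow> p < q \<Longrightarrow>
       \<not> (frequently (\<lambda>h. Q h < p) F \<and> frequently (\<lambda>h. q < Q h) F)"
  shows "\<exists>l. (Q \<longlongrightarrow> l) F"
proof -
  define i where "i = Liminf F (\<lambda>h. ereal (Q h))"
  define s where "s = Limsup F (\<lambda>h. ereal (Q h))"
  have "i \<le> s" unfolding i_def s_def by (rule Liminf_le_Limsup[OF F])
  moreover have "\<not> i < s"
  proof
    assume "i < s"
    then obtain p where p: "i < ereal (real_of_rat p)" "ereal (real_of_rat p) < s" using ereal_dense3 by blast
    obtain q where q: "ereal (real_of_rat p) < ereal (real_of_rat q)" "ereal (real_of_rat q) < s"
      using ereal_dense3[OF p(2)] by blast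
    have "\<not> eventually (\<lambda>h. ereal (real_of_rat p) \<le> ereal (Q h)) F"
      using p(1) Liminf_bounded[of "ereal (real_of_rat p)" "\<lambda>h. ereal (Q h)" F]
      unfolding i_def[symmetric] by auto
    then have 1: "frequently (\<lambda>h. Q h < real_of_rat p) F"
      by (simp add: frequently_def not_less)
    have "\<not> eventually (\<lambda>h. ereal (Q h) \<le> ereal (real_of_rat q)) F"
      using q(2) Limsup_bounded[of "\<lambda>h. ereal (Q h)" "ereal (real_of_rat q)" F]
      unfolding s_def[symmetric] by auto
    then have "frequently (\<lambda>h. real_of_rat q < Q h) F"
      by (simp add: frequently_def not_less)
    with 1 q(1) osc[of "real_of_rat p" "real_of_rat q"] show False by auto
  qed
  ultimately have "i = s" by simp
  then have lim: "((\<lambda>h. ereal (Q h)) \<longlongrightarrow> i) F"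
    unfolding i_def s_def by (intro Liminf_eq_Limsup F) auto
  have "ereal (- B) \<le> i" unfolding i_def
    by (rule Liminf_bounded) (use bdd in \<open>auto elim!: eventually_mono\<close>)
  moreover have "i \<le> ereal B" unfolding \<open>i = s\<close> s_def
    by (rule Limsup_bounded) (use bdd in \<open>auto elim!: eventually_mono\<close>)
  ultimately obtain l where "i = ereal l" by (cases i) auto
  then show ?thesis using lim by auto
qed

lemma lipschitz_AE_directional_derivative:
  fixes w :: "'a::euclidean_space \<Rightarrow> real"
  assumes w: "L-lipschitz_on UNIV w"
  shows "AE x in lborel. \<exists>l. ((\<lambda>s. w (x + s *\<^sub>R e)) has_field_derivative l) (at 0)"
proof -
  define R :: "(real \<times> real) set" where "R = {(p, q). p \<in> \<rat> \<and> q \<in> \<rat> \<and> p < q}"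
  have "countable R"
    by (rule countable_subset[of _ "\<rat> \<times> \<rat>"]) (auto simp: R_def countable_rat)
  then have "(\<Union>z\<in>R. oscillation_set w e (fst z) (snd z)) \<in> null_sets lborel"
    by (intro null_sets_UN') (auto simp: R_def intro!: null_oscillation_set[OF w])
  then have "AE x in lborel. x \<notin> (\<Union>z\<in>R. oscillation_set w e (fst z) (snd z))"
    by (rule AE_not_in)
  then show ?thesis
  proof eventually_elim
    case (elim x)
    define Q where "Q h = (w (x + h *\<^sub>R e) - w x) / h" for h
    have "\<exists>l. (Q \<longlongrightarrow> l) (at 0)"
    proof (rule convergent_of_no_oscillation)
      show "eventually (\<lambda>h. \<bar>Q h\<bar> \<le> L * norm e) (at 0)"
      proof (rule eventually_at_topological[THEN iffD2], intro exI[of _ UNIV] conjI ballI impI)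
        fix h :: real assume h: "h \<noteq> 0"
        show "\<bar>Q h\<bar> \<le> L * norm e"
          unfolding Q_def by (rule lipschitz_difference_quotient_le[OF w h])
      qed auto
      fix p q :: real assume "p \<in> \<rat>" "q \<in> \<rat>" "p < q"
      then have "x \<notin> oscillation_set w e p q" using elim by (force simp: R_def)
      then show "\<not> (frequently (\<lambda>h. Q h < p) (at 0) \<and> frequently (\<lambda>h. q < Q h) (at 0))"
        unfolding oscillation_set_def Q_def frequently_at by (auto simp: dist_real_def)
    qed simp
    then obtain l where "(Q \<longlongrightarrow> l) (at 0)" by auto
    then have "((\<lambda>s. w (x + s *\<^sub>R e)) has_field_derivative l) (at 0)"
      by (simp add: DERIV_def Q_def[abs_def])
    then show ?case by blast
  qed
qed

text \<open>The integrals below require a measurable derivative, so it is taken as the limit along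
  the steps \<open>1 / Suc k\<close>. Where that sequence diverges \<open>lim\<close> yields some
  arbitrary value, but this happens only on a null set.\<close>

lemma lipschitz_borel_directional_derivative:
  fixes w :: "'a::euclidean_space \<Rightarrow> real"
  assumes w: "L-lipschitz_on UNIV w"
  obtains D where "D \<in> borel_measurable borel"
    "AE x in lborel. ((\<lambda>s. w (x + s *\<^sub>R e)) has_field_derivative D x) (at 0)"
proof -
  have [measurable]: "w \<in> borel_measurable borel"
    by (rule borel_measurable_continuous_onI[OF lipschitz_on_continuous_on[OF w]])
  define Q where "Q k x = (w (x + (1 / real (Suc k)) *\<^sub>R e) - w x) / (1 / real (Suc k))" for k x
  define D where "D x = lim (\<lambda>k. Q k x)" for x
  have [measurable]: "Q k \<in> borel_measurable borel" for k unfolding Q_def by measurable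
  have D: "D \<in> borel_measurable borel" unfolding D_def by measurable
  have hlim: "filterlim (\<lambda>k. 1 / real (Suc k)) (at 0) sequentially"
    by (intro filterlim_atI LIMSEQ_Suc[OF lim_1_over_n]) auto
  have ae: "AE x in lborel. ((\<lambda>s. w (x + s *\<^sub>R e)) has_field_derivative D x) (at 0)"
    using lipschitz_AE_directional_derivative[OF w, of e]
  proof eventually_elim
    case (elim x)
    then obtain l where l: "((\<lambda>s. w (x + s *\<^sub>R e)) has_field_derivative l) (at 0)" by auto
    then have "((\<lambda>h. (w (x + h *\<^sub>R e) - w x) / h) \<longlongrightarrow> l) (at 0)" by (simp add: DERIV_def)
    from filterlim_compose[OF this hlim] have lim: "(\<lambda>k. Q k x) \<longlonglongrightarrow> l" by (simp add: Q_def)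
    then have "D x = l" unfolding D_def by (rule limI)
    then show ?case using l by simp
  qed
  show thesis by (rule that[OF D ae])
qed

section \<open>Integrals of directional derivatives\<close>

lemma integral_lborel_shift:
  fixes w :: "'a::euclidean_space \<Rightarrow> real"
  assumes [measurable]: "w \<in> borel_measurable borel"
  shows "(\<integral>x. w (x + v) \<partial>lborel) = (\<integral>x. w x \<partial>lborel)"
    and "integrable lborel (\<lambda>x. w (x + v)) \<longleftrightarrow> integrable lborel w"
proof -
  have "(\<integral>x. w x \<partial>(distr lborel borel ((+) v))) = (\<integral>x. w (v + x) \<partial>lborel)"
    by (subst integral_distr) auto
  then show "(\<integral>x. w (x + v) \<partial>lborel) = (\<integral>x. w x \<partial>lborel)"
    by (simp add: lborel_distr_plus add.commute)
  have "integrable (distr lborel borel ((+) v)) w \<longleftrightarrow> integrable lborel (\<lambda>x. w (v + x))"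
    by (subst integrable_distr_eq) auto
  then show "integrable lborel (\<lambda>x. w (x + v)) \<longleftrightarrow> integrable lborel w"
    by (simp add: lborel_distr_plus add.commute)
qed

lemma integrable_bounded_support:
  fixes w :: "'a::euclidean_space \<Rightarrow> real"
  assumes "w \<in> borel_measurable borel" "AE x in lborel. \<bar>w x\<bar> \<le> B"
    and "AE x in lborel. x \<notin> cball 0 R \<longrightarrow> w x = 0"
  shows "integrable lborel w"
proof (rule Bochner_Integration.integrable_bound)
  show "integrable lborel (\<lambda>x. indicator (cball 0 R :: 'a set) x * B)"
    by (intro integrable_mult_left integrable_real_indicator) (use emeasure_bounded_finite[OF bounded_cball] in auto)
  show "AE x in lborel. norm (w x) \<le> norm (indicator (cball 0 R :: 'a set) x * B)"
    using assms(2,3) by eventually_elim (auto simp: indicator_def abs_le_iff)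
qed (use assms in auto)

lemma integral_directional_derivative:
  fixes w :: "'a::euclidean_space \<Rightarrow> real"
  assumes w: "L-lipschitz_on UNIV w" and supp: "\<And>x. x \<notin> cball 0 R \<Longrightarrow> w x = 0"
    and D: "D \<in> borel_measurable borel"
      "AE x in lborel. ((\<lambda>s. w (x + s *\<^sub>R e)) has_field_derivative D x) (at 0)"
  shows "integrable lborel D" and "(\<integral>x. D x \<partial>lborel) = 0"
proof -
  have wc: "continuous_on UNIV w" by (rule lipschitz_on_continuous_on[OF w])
  have [measurable]: "w \<in> borel_measurable borel" by (rule borel_measurable_continuous_onI[OF wc])
  obtain B where B: "\<And>x. \<bar>w x\<bar> \<le> B"
  proof -
    have "bounded (w ` cball 0 R)"
      by (intro compact_imp_bounded compact_continuous_image continuous_on_subset[OF wc]) auto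
    then obtain B where "\<forall>y\<in>w ` cball 0 R. \<bar>y\<bar> \<le> B" unfolding bounded_real by blast
    then have "\<And>x. x \<in> cball 0 R \<Longrightarrow> \<bar>w x\<bar> \<le> B" by blast
    then have "\<bar>w x\<bar> \<le> max B 0" for x using supp[of x] by (cases "x \<in> cball 0 R") force+
    then show thesis by (rule that)
  qed
  have w_int: "integrable lborel w"
    by (rule integrable_bounded_support[of _ B R]) (use B supp in auto)
  define Q where "Q k x = (w (x + (1 / real (Suc k)) *\<^sub>R e) - w x) / (1 / real (Suc k))" for k x
  have [measurable]: "Q k \<in> borel_measurable borel" for k unfolding Q_def by measurable
  have hlim: "filterlim (\<lambda>k. 1 / real (Suc k)) (at 0) sequentially"
    by (intro filterlim_atI LIMSEQ_Suc[OF lim_1_over_n]) auto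
  have lim: "AE x in lborel. (\<lambda>k. Q k x) \<longlonglongrightarrow> D x"
    using D(2)
  proof eventually_elim
    case (elim x)
    then have "((\<lambda>h. (w (x + h *\<^sub>R e) - w x) / h) \<longlongrightarrow> D x) (at 0)" by (simp add: DERIV_def)
    from filterlim_compose[OF this hlim] show ?case by (simp add: Q_def)
  qed
  \<comment> \<open>The steps \<open>1 / Suc k\<close> are at most 1, so all quotients vanish
    outside the ball of radius \<open>R + norm e\<close>, and inside it they share the Lipschitz
    bound.\<close>
  let ?W = "\<lambda>x. indicator (cball 0 (R + norm e) :: 'a set) x * (L * norm e)"
  have L: "0 \<le> L" using w lipschitz_on_nonneg by blast
  have bound: "AE x in lborel. norm (Q k x) \<le> ?W x" for k
  proof (rule AE_I2)
    fix x
    show "norm (Q k x) \<le> ?W x"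
    proof (cases "x \<in> cball 0 (R + norm e)")
      case True
      then show ?thesis
        using lipschitz_difference_quotient_le[OF w, of "1 / real (Suc k)" x e]
        by (simp add: Q_def)
    next
      case False
      have "norm ((1 / real (Suc k)) *\<^sub>R e) \<le> norm e"
        using mult_left_mono[of 1 "1 + real k" "norm e"] by (simp add: divide_simps)
      moreover have "norm x \<le> norm (x + (1 / real (Suc k)) *\<^sub>R e) + norm ((1 / real (Suc k)) *\<^sub>R e)"
        using norm_triangle_ineq4[of "x + (1 / real (Suc k)) *\<^sub>R e" "(1 / real (Suc k)) *\<^sub>R e"] by simp
      moreover have "R + norm e < norm x" using False by simp
      ultimately have "x \<notin> cball 0 R" "x + (1 / real (Suc k)) *\<^sub>R e \<notin> cball 0 R"
        using norm_ge_zero[of e] unfolding mem_cball_0 by linarith+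
      then have "Q k x = 0" by (simp add: Q_def supp)
      then show ?thesis using L by simp
    qed
  qed
  have W: "integrable lborel ?W"
    by (intro integrable_mult_left integrable_real_indicator) (use emeasure_bounded_finite[OF bounded_cball] in auto)
  show "integrable lborel D"
    by (rule integrable_dominated_convergence[OF _ _ W lim bound]) (use D in auto)
  have "(\<lambda>k. \<integral>x. Q k x \<partial>lborel) \<longlonglongrightarrow> (\<integral>x. D x \<partial>lborel)"
    by (rule integral_dominated_convergence[OF _ _ W lim bound]) (use D in auto)
  moreover have "(\<integral>x. Q k x \<partial>lborel) = 0" for k
    unfolding Q_def using integral_lborel_shift[of w] w_int by simp
  ultimately show "(\<integral>x. D x \<partial>lborel) = 0" by (simp add: LIMSEQ_const_iff)
qed

lemma integrable_mult_AE_bounded: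
  fixes g h :: "'a::euclidean_space \<Rightarrow> real"
  assumes g: "integrable lborel g" and [measurable]: "h \<in> borel_measurable borel"
    and c: "AE x in lborel. \<bar>h x\<bar> \<le> c"
  shows "integrable lborel (\<lambda>x. g x * h x)"
    and "\<bar>\<integral>x. g x * h x \<partial>lborel\<bar> \<le> c * (\<integral>x. \<bar>g x\<bar> \<partial>lborel)"
proof -
  have ae: "AE x in lborel. \<bar>g x * h x\<bar> \<le> c * \<bar>g x\<bar>"
    using c
  proof eventually_elim
    case (elim x)
    then have "\<bar>g x\<bar> * \<bar>h x\<bar> \<le> \<bar>g x\<bar> * c" by (intro mult_left_mono) auto
    then show ?case by (simp add: abs_mult mult.commute)
  qed
  show int: "integrable lborel (\<lambda>x. g x * h x)"
  proof (rule Bochner_Integration.integrable_bound)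
    show "integrable lborel (\<lambda>x. c * \<bar>g x\<bar>)" using g by simp
    show "AE x in lborel. norm (g x * h x) \<le> norm (c * \<bar>g x\<bar>)"
      using ae by eventually_elim auto
  qed (use g in auto)
  have "\<bar>\<integral>x. g x * h x \<partial>lborel\<bar> \<le> (\<integral>x. \<bar>g x * h x\<bar> \<partial>lborel)"
    by (rule integral_abs_bound)
  also have "\<dots> \<le> (\<integral>x. c * \<bar>g x\<bar> \<partial>lborel)"
    by (rule integral_mono_AE) (use g int ae in auto)
  finally show "\<bar>\<integral>x. g x * h x \<partial>lborel\<bar> \<le> c * (\<integral>x. \<bar>g x\<bar> \<partial>lborel)" by simp
qed

lemma integrable_mult_bounded:
  fixes g u :: "'a::euclidean_space \<Rightarrow> real"
  assumes "integrable lborel g" "u \<in> borel_measurable borel" "\<And>x. \<bar>u x\<bar> \<le> U"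
  shows "integrable lborel (\<lambda>x. g x * u x)"
  using integrable_mult_AE_bounded(1)[OF assms(1,2), of U] assms(3) by simp

lemma directional_derivative_le_lipschitz:
  fixes w :: "'a::real_normed_vector \<Rightarrow> real"
  assumes w: "L-lipschitz_on UNIV w"
    and D: "((\<lambda>s. w (x + s *\<^sub>R e)) has_field_derivative D) (at 0)"
  shows "\<bar>D\<bar> \<le> L * norm e"
proof (rule tendsto_upperbound)
  have "((\<lambda>h. (w (x + h *\<^sub>R e) - w x) / h) \<longlongrightarrow> D) (at 0)" using D by (simp add: DERIV_def)
  then show "((\<lambda>h. \<bar>(w (x + h *\<^sub>R e) - w x) / h\<bar>) \<longlongrightarrow> \<bar>D\<bar>) (at 0)" by (rule tendsto_rabs)
  show "eventually (\<lambda>h. \<bar>(w (x + h *\<^sub>R e) - w x) / h\<bar> \<le> L * norm e) (at 0)"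
    unfolding eventually_at_topological
    by (intro exI[of _ UNIV] conjI ballI impI open_UNIV UNIV_I lipschitz_difference_quotient_le[OF w])
qed simp

lemma directional_derivative_eq_0:
  fixes w :: "'a::real_normed_vector \<Rightarrow> real"
  assumes "closed S" "x \<notin> S" and zero: "\<And>y. y \<notin> S \<Longrightarrow> w y = 0"
    and D: "((\<lambda>s. w (x + s *\<^sub>R e)) has_field_derivative D) (at 0)"
  shows "D = 0"
proof -
  have "((\<lambda>s::real. x + s *\<^sub>R e) \<longlongrightarrow> x + 0 *\<^sub>R e) (nhds 0)"
    by (intro tendsto_intros filterlim_ident)
  then have "eventually (\<lambda>s. x + s *\<^sub>R e \<in> - S) (nhds (0::real))"
    by (rule topological_tendstoD) (use assms in auto)
  then have "eventually (\<lambda>s. w (x + s *\<^sub>R e) = 0) (nhds (0::real))"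
    by eventually_elim (use zero in auto)
  then have "((\<lambda>s. w (x + s *\<^sub>R e)) has_field_derivative 0) (at 0)"
    by (subst DERIV_cong_ev[OF refl _ refl, where g = "\<lambda>_. 0"]) auto
  then show ?thesis using D DERIV_unique by blast
qed

lemma lipschitz_on_inner_Basis:
  fixes Y :: "'a::metric_space \<Rightarrow> 'b::euclidean_space"
  assumes Y: "L-lipschitz_on S Y" and e: "e \<in> Basis"
  shows "L-lipschitz_on S (\<lambda>x. Y x \<bullet> e)"
proof (rule lipschitz_onI)
  fix x y assume xy: "x \<in> S" "y \<in> S"
  have "\<bar>(Y x - Y y) \<bullet> e\<bar> \<le> norm (Y x - Y y)" using Basis_le_norm[OF e, of "Y x - Y y"] by simp
  also have "\<dots> \<le> L * dist x y" using lipschitz_onD[OF Y xy] by (simp add: dist_norm)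
  finally show "dist (Y x \<bullet> e) (Y y \<bullet> e) \<le> L * dist x y" by (simp add: dist_real_def inner_diff_left)
qed (rule lipschitz_on_nonneg[OF Y])

subsection \<open>Flows of globally Lipschitz vector fields\<close>

text \<open>The point is one \<open>T\<close> for all starting points: Picard's map contracts on a
  time interval whose length depends on \<open>L\<close> alone. The bound \<open>M\<close> keeps
  that map within the bounded continuous functions.\<close>

lemma picard_lindelof_global:
  fixes X :: "'a::euclidean_space \<Rightarrow> 'a"
  assumes X: "L-lipschitz_on UNIV X" and M: "\<And>x. norm (X x) \<le> M"
  obtains T where "0 < T"
    "\<And>x. \<exists>\<gamma>. \<gamma> 0 = x \<and> (\<forall>t. \<bar>t\<bar> < T \<longrightarrow> (\<gamma> has_vector_derivative X (\<gamma> t)) (at t))"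
proof -
  have L: "0 \<le> L" using X lipschitz_on_nonneg by blast
  \<comment> \<open>At each of the times \<open>c t\<close> and 0 the integrals for two curves
    differ by at most \<open>L * (2 * T)\<close> times the distance of the curves, hence the factor
    \<open>4 * L * T\<close>, here at most 1/2. Using \<open>L + 1\<close> avoids division by
    zero.\<close>
  define T where "T = 1 / (8 * (L + 1))"
  have T: "0 < T" and LT: "4 * L * T \<le> 1/2" using L by (auto simp: T_def field_simps)
  have M0: "0 \<le> M" using M[of 0] norm_ge_zero order_trans by blast
  \<comment> \<open>Clamping time to the interval from \<open>-T\<close> to \<open>T\<close> lets
    the fixed point be sought among bounded continuous functions on the whole line, a complete
    space; within the interval \<open>c\<close> is the identity.\<close>
  define c where "c t = max (-T) (min T t)" for t
  have c: "c t \<in> {-T..T}" for t using T by (auto simp: c_def)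
  have c_cont: "continuous_on UNIV c" unfolding c_def by (intro continuous_intros)
  have X_cont: "continuous_on UNIV X" by (rule lipschitz_on_continuous_on[OF X])
  have Xy_cont: "continuous_on S (\<lambda>s. X (apply_bcontfun y s))" for S and y :: "real \<Rightarrow>\<^sub>C 'a"
    by (rule continuous_on_compose2[OF X_cont]) (auto intro: continuous_on_apply_bcontfun)
  \<comment> \<open>Integrating from \<open>-T\<close> and later subtracting the value at 0 covers
    both signs of time with one formula.\<close>
  define J where "J y r = integral {-T..r} (\<lambda>s. X (apply_bcontfun y s))" for y :: "real \<Rightarrow>\<^sub>C 'a" and r
  have "\<exists>\<gamma>. \<gamma> 0 = x \<and> (\<forall>t. \<bar>t\<bar> < T \<longrightarrow> (\<gamma> has_vector_derivative X (\<gamma> t)) (at t))" for x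
  proof -
    define G where "G y t = x + J y (c t) - J y 0" for y :: "real \<Rightarrow>\<^sub>C 'a" and t
    have G: "G y \<in> bcontfun" for y
    proof (rule bcontfun_normI)
      have "continuous_on {-T..T} (J y)"
        unfolding J_def by (intro indefinite_integral_continuous_1 integrable_continuous_interval Xy_cont)
      then have "continuous_on UNIV (\<lambda>t. J y (c t))"
        by (rule continuous_on_compose2[OF _ c_cont]) (use c in auto)
      then show "continuous_on UNIV (G y)" unfolding G_def by (intro continuous_intros)
      fix t
      have "norm (J y (c t)) \<le> M * (c t - - T)"
        unfolding J_def using c[of t] M by (intro integral_bound Xy_cont) auto
      also have "\<dots> \<le> M * (2 * T)" using c[of t] M0 by (intro mult_left_mono) auto
      finally have "norm (J y (c t)) \<le> M * (2 * T)" .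
      then show "norm (G y t) \<le> norm x + M * (2 * T) + norm (J y 0)"
        using norm_triangle_ineq4[of "x + J y (c t)" "J y 0"] norm_triangle_ineq[of x "J y (c t)"]
        unfolding G_def by linarith
    qed
    have J_diff: "norm (J y r - J z r) \<le> L * dist y z * (2 * T)" if "r \<in> {-T..T}" for y z r
    proof -
      have "norm (J y r - J z r) = norm (integral {-T..r} (\<lambda>s. X (apply_bcontfun y s) - X (apply_bcontfun z s)))"
        unfolding J_def by (subst integral_diff) (auto intro: integrable_continuous_interval Xy_cont)
      also have "\<dots> \<le> (L * dist y z) * (r - - T)"
      proof (rule integral_bound)
        show "norm (X (apply_bcontfun y t) - X (apply_bcontfun z t)) \<le> L * dist y z" for t
        proof -
          have "norm (X (apply_bcontfun y t) - X (apply_bcontfun z t)) \<le> L * dist (apply_bcontfun y t) (apply_bcontfun z t)"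
            using lipschitz_onD[OF X, of "apply_bcontfun y t" "apply_bcontfun z t"] by (simp add: dist_norm)
          also have "\<dots> \<le> L * dist y z" by (intro mult_left_mono L dist_bounded)
          finally show "norm (X (apply_bcontfun y t) - X (apply_bcontfun z t)) \<le> L * dist y z" .
        qed
      qed (use that in \<open>auto intro!: continuous_intros Xy_cont\<close>)
      also have "\<dots> \<le> (L * dist y z) * (2 * T)" using that L by (intro mult_left_mono) auto
      finally show ?thesis .
    qed
    define P where "P y = Bcontfun (G y)" for y
    have P: "apply_bcontfun (P y) = G y" for y unfolding P_def using G by (rule Bcontfun_inverse)
    have contr: "dist (P y) (P z) \<le> 1/2 * dist y z" for y z
    proof (rule dist_bound)
      fix t
      have "dist (G y t) (G z t) = norm ((J y (c t) - J z (c t)) - (J y 0 - J z 0))"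
        by (simp add: G_def dist_norm algebra_simps)
      also have "\<dots> \<le> norm (J y (c t) - J z (c t)) + norm (J y 0 - J z 0)"
        by (rule norm_triangle_ineq4)
      also have "\<dots> \<le> L * dist y z * (2 * T) + L * dist y z * (2 * T)"
        using c T by (intro add_mono J_diff) auto
      also have "\<dots> = (4 * L * T) * dist y z" by simp
      also have "\<dots> \<le> 1/2 * dist y z" by (intro mult_right_mono LT) auto
      finally show "dist (apply_bcontfun (P y) t) (apply_bcontfun (P z) t) \<le> 1/2 * dist y z" by (simp add: P)
    qed
    then obtain y where y: "P y = y"
      using banach_fix_type[of "1/2" P] by auto
    define \<gamma> where "\<gamma> = apply_bcontfun y"
    have \<gamma>: "\<gamma> t = x + J y (c t) - J y 0" for t
      using P[of y] by (simp add: y \<gamma>_def G_def)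
    have "(\<gamma> has_vector_derivative X (\<gamma> t)) (at t)" if t: "\<bar>t\<bar> < T" for t
    proof -
      have "(J y has_vector_derivative X (\<gamma> t)) (at t within {-T..T})"
        unfolding J_def \<gamma>_def using t by (intro integral_has_vector_derivative Xy_cont) auto
      then have "(J y has_vector_derivative X (\<gamma> t)) (at t)"
        using t by (subst (asm) at_within_interior) (auto simp: interior_atLeastAtMost_real)
      then have "((\<lambda>t. x + J y t - J y 0) has_vector_derivative X (\<gamma> t)) (at t)"
        by (auto intro!: derivative_eq_intros)
      then show ?thesis
        by (rule has_vector_derivative_transform_within_open[where S = "{-T<..<T}"])
          (use t in \<open>auto simp: \<gamma> c_def\<close>)
    qed
    moreover have "\<gamma> 0 = x" using T by (simp add: \<gamma> c_def)
    ultimately show ?thesis by blast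
  qed
  then show thesis by (rule that[OF T])
qed

text \<open>Gronwall's inequality in differential form: the squared distance times
  \<open>exp (- 2 * L * r)\<close> does not increase. The square is differentiable even where the
  curves meet. The set \<open>S\<close> allows a field that is Lipschitz only on the compact range
  of two given curves.\<close>

lemma solution_dist_le:
  fixes X :: "'a::euclidean_space \<Rightarrow> 'a"
  assumes X: "L-lipschitz_on S X" and "a \<le> b"
    and \<gamma>: "\<And>t. t \<in> {a..b} \<Longrightarrow> \<gamma> t \<in> S \<and> (\<gamma> has_vector_derivative X (\<gamma> t)) (at t)"
    and \<eta>: "\<And>t. t \<in> {a..b} \<Longrightarrow> \<eta> t \<in> S \<and> (\<eta> has_vector_derivative X (\<eta> t)) (at t)"
  shows "dist (\<gamma> b) (\<eta> b) \<le> exp (L * (b - a)) * dist (\<gamma> a) (\<eta> a)"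
proof -
  define v where "v r = exp (- 2 * L * r) * ((\<gamma> r - \<eta> r) \<bullet> (\<gamma> r - \<eta> r))" for r
  have "v b \<le> v a"
  proof (rule DERIV_nonpos_imp_nonincreasing[OF \<open>a \<le> b\<close>])
    fix r assume r: "a \<le> r" "r \<le> b"
    let ?d = "\<gamma> r - \<eta> r" and ?e = "X (\<gamma> r) - X (\<eta> r)"
    have d: "((\<lambda>r. \<gamma> r - \<eta> r) has_vector_derivative ?e) (at r)"
      using \<gamma>[of r] \<eta>[of r] r by (auto intro!: derivative_intros)
    have "((\<lambda>r. (\<gamma> r - \<eta> r) \<bullet> (\<gamma> r - \<eta> r)) has_vector_derivative (?d \<bullet> ?e + ?e \<bullet> ?d)) (at r)"
      by (rule bounded_bilinear.has_vector_derivative[OF bounded_bilinear_inner d d])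
    then have dd: "((\<lambda>r. (\<gamma> r - \<eta> r) \<bullet> (\<gamma> r - \<eta> r)) has_real_derivative (2 * (?d \<bullet> ?e))) (at r)"
      by (simp add: has_real_derivative_iff_has_vector_derivative inner_commute)
    have "(v has_real_derivative exp (- 2 * L * r) * (2 * (?d \<bullet> ?e) - 2 * L * (?d \<bullet> ?d))) (at r)"
      unfolding v_def by (rule DERIV_cong[OF DERIV_mult[OF _ dd]]) (auto intro!: derivative_eq_intros simp: algebra_simps)
    moreover have "?d \<bullet> ?e \<le> L * (?d \<bullet> ?d)"
    proof -
      have "?d \<bullet> ?e \<le> norm ?d * norm ?e" by (rule norm_cauchy_schwarz)
      also have "\<dots> \<le> norm ?d * (L * norm ?d)"
        using lipschitz_on_normD[OF X] \<gamma>[of r] \<eta>[of r] r by (intro mult_left_mono) auto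
      also have "\<dots> = L * (?d \<bullet> ?d)" by (simp add: dot_square_norm power2_eq_square)
      finally show ?thesis .
    qed
    then have "exp (- 2 * L * r) * (2 * (?d \<bullet> ?e) - 2 * L * (?d \<bullet> ?d)) \<le> 0"
      by (intro mult_nonneg_nonpos) auto
    ultimately show "\<exists>y. (v has_real_derivative y) (at r) \<and> y \<le> 0" by blast
  qed
  then have "exp (- 2 * L * b) * (dist (\<gamma> b) (\<eta> b))\<^sup>2 \<le> exp (- 2 * L * a) * (dist (\<gamma> a) (\<eta> a))\<^sup>2"
    by (simp add: v_def dist_norm dot_square_norm)
  then have "exp (2 * L * b) * (exp (- 2 * L * b) * (dist (\<gamma> b) (\<eta> b))\<^sup>2)
      \<le> exp (2 * L * b) * (exp (- 2 * L * a) * (dist (\<gamma> a) (\<eta> a))\<^sup>2)"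
    by (rule mult_left_mono) simp
  moreover have "exp (2 * L * b) * exp (- 2 * L * b) = 1"
    by (subst exp_add[symmetric]) simp
  moreover have "exp (2 * L * b) * exp (- 2 * L * a) = exp (2 * (L * (b - a)))"
    by (subst exp_add[symmetric]) (simp add: algebra_simps)
  ultimately have "(dist (\<gamma> b) (\<eta> b))\<^sup>2 \<le> exp (2 * (L * (b - a))) * (dist (\<gamma> a) (\<eta> a))\<^sup>2"
    by (simp only: mult.assoc[symmetric] mult_1_left)
  then have "(dist (\<gamma> b) (\<eta> b))\<^sup>2 \<le> (exp (L * (b - a)) * dist (\<gamma> a) (\<eta> a))\<^sup>2"
    by (simp add: power_mult_distrib exp_double)
  then show ?thesis by (rule power2_le_imp_le) simp
qed

lemma solution_dist_le_abs:
  fixes X :: "'a::euclidean_space \<Rightarrow> 'a"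
  assumes X: "L-lipschitz_on S X"
    and \<gamma>: "\<And>s. s \<in> closed_segment 0 t \<Longrightarrow> \<gamma> s \<in> S \<and> (\<gamma> has_vector_derivative X (\<gamma> s)) (at s)"
    and \<eta>: "\<And>s. s \<in> closed_segment 0 t \<Longrightarrow> \<eta> s \<in> S \<and> (\<eta> has_vector_derivative X (\<eta> s)) (at s)"
  shows "dist (\<gamma> t) (\<eta> t) \<le> exp (L * \<bar>t\<bar>) * dist (\<gamma> 0) (\<eta> 0)"
proof (cases "0 \<le> t")
  case True
  then show ?thesis
    using solution_dist_le[OF X True] \<gamma> \<eta> by (simp add: closed_segment_eq_real_ivl)
next
  case False
  \<comment> \<open>Reversing time turns solutions for \<open>X\<close> into solutions for
    \<open>- X\<close>, which has the same Lipschitz constant; so negative \<open>t\<close> reduces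
    to the forward estimate.\<close>
  have rev: "((\<lambda>r. \<zeta> (- r)) has_vector_derivative - X (\<zeta> (- s))) (at s)"
    if "(\<zeta> has_vector_derivative X (\<zeta> (- s))) (at (- s))" for \<zeta> s
  proof -
    have "((\<lambda>r. \<zeta> (- r)) has_vector_derivative (- 1) *\<^sub>R X (\<zeta> (- s))) (at s)"
    proof (rule vector_diff_chain_at[of uminus "- 1" s \<zeta>, unfolded o_def])
      show "(uminus has_vector_derivative - 1) (at s)" for s :: real
        by (auto intro!: derivative_eq_intros)
    qed (rule that)
    then show ?thesis by simp
  qed
  have "dist (\<gamma> (- (- t))) (\<eta> (- (- t))) \<le> exp (L * (- t - 0)) * dist (\<gamma> (- 0)) (\<eta> (- 0))"
  proof (rule solution_dist_le[where X = "\<lambda>x. - X x" and \<gamma> = "\<lambda>r. \<gamma> (- r)" and \<eta> = "\<lambda>r. \<eta> (- r)"])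
    show "L-lipschitz_on S (\<lambda>x. - X x)" using X by simp
    show "\<gamma> (- s) \<in> S \<and> ((\<lambda>r. \<gamma> (- r)) has_vector_derivative - X (\<gamma> (- s))) (at s)" if "s \<in> {0..- t}" for s
      using \<gamma>[of "- s"] that rev[of \<gamma> s] False by (auto simp: closed_segment_eq_real_ivl)
    show "\<eta> (- s) \<in> S \<and> ((\<lambda>r. \<eta> (- r)) has_vector_derivative - X (\<eta> (- s))) (at s)" if "s \<in> {0..- t}" for s
      using \<eta>[of "- s"] that rev[of \<eta> s] False by (auto simp: closed_segment_eq_real_ivl)
  qed (use False in auto)
  then show ?thesis using False by simp
qed

text \<open>One time bound serves all starting points. Nothing is assumed about
  \<open>\<phi> t\<close> for \<open>\<bar>t\<bar> \<ge> T\<close>, so each use of the flow has to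
  check that its times stay below \<open>T\<close>.\<close>

locale lipschitz_flow =
  fixes X :: "'a::euclidean_space \<Rightarrow> 'a" and L M T :: real and \<phi> :: "real \<Rightarrow> 'a \<Rightarrow> 'a"
  assumes X_lipschitz: "L-lipschitz_on UNIV X" and X_bound: "\<And>x. norm (X x) \<le> M"
    and T_pos: "0 < T" and flow_0: "\<And>x. \<phi> 0 x = x"
    and flow_deriv: "\<And>t x. \<bar>t\<bar> < T \<Longrightarrow> ((\<lambda>s. \<phi> s x) has_vector_derivative X (\<phi> t x)) (at t)"
begin

lemma L_nonneg: "0 \<le> L" using X_lipschitz lipschitz_on_nonneg by blast

lemma M_nonneg: "0 \<le> M" using X_bound[of 0] norm_ge_zero order_trans by blast

lemma abs_less_of_segment: "s \<in> closed_segment 0 t \<Longrightarrow> \<bar>t\<bar> < T \<Longrightarrow> \<bar>s\<bar> < T"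
  by (auto simp: closed_segment_eq_real_ivl split: if_splits)

lemma flow_lipschitz:
  assumes t: "\<bar>t\<bar> < T"
  shows "(exp (L * \<bar>t\<bar>))-lipschitz_on UNIV (\<phi> t)"
proof (rule lipschitz_onI)
  fix x y
  have "dist (\<phi> t x) (\<phi> t y) \<le> exp (L * \<bar>t\<bar>) * dist (\<phi> 0 x) (\<phi> 0 y)"
    by (rule solution_dist_le_abs[OF X_lipschitz]) (use abs_less_of_segment t flow_deriv in auto)
  then show "dist (\<phi> t x) (\<phi> t y) \<le> exp (L * \<bar>t\<bar>) * dist x y" by (simp add: flow_0)
qed simp

lemma flow_continuous: "\<bar>t\<bar> < T \<Longrightarrow> continuous_on S (\<phi> t)"
  using flow_lipschitz lipschitz_on_continuous_on continuous_on_subset by blast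

lemma flow_dist:
  assumes t: "\<bar>t\<bar> < T"
  shows "norm (\<phi> t x - x) \<le> M * \<bar>t\<bar>"
proof -
  have "norm (\<phi> t x - \<phi> 0 x) \<le> M * norm (t - 0)"
  proof (rule differentiable_bound[of "{-T<..<T}" "\<lambda>s. \<phi> s x" "\<lambda>s h. h *\<^sub>R X (\<phi> s x)"])
    fix s assume "s \<in> {-T<..<T}"
    then show "((\<lambda>s. \<phi> s x) has_derivative (\<lambda>h. h *\<^sub>R X (\<phi> s x))) (at s within {-T<..<T})"
      using flow_deriv[of s x] by (auto simp: has_vector_derivative_def intro: has_derivative_at_withinI)
    show "onorm (\<lambda>h. h *\<^sub>R X (\<phi> s x)) \<le> M"
    proof (rule onorm_bound[OF M_nonneg])
      show "norm (h *\<^sub>R X (\<phi> s x)) \<le> M * norm h" for h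
        using mult_right_mono[OF X_bound[of "\<phi> s x"] abs_ge_zero[of h]] by (simp add: mult.commute)
    qed
  qed (use t in auto)
  then show ?thesis by (simp add: flow_0)
qed

text \<open>The shifted orbit and the orbit started at \<open>\<phi> t x\<close> are two solutions
  with the same initial value, so the distance estimate makes them agree. On the segment from 0 to
  \<open>- t\<close> the shifted time \<open>t + s\<close> runs between \<open>t\<close> and 0 and
  thus respects the time bound.\<close>

lemma flow_inverse:
  assumes t: "\<bar>t\<bar> < T"
  shows "\<phi> (- t) (\<phi> t x) = x"
proof -
  have "dist (\<phi> (t + - t) x) (\<phi> (- t) (\<phi> t x)) \<le> exp (L * \<bar>- t\<bar>) * dist (\<phi> (t + 0) x) (\<phi> 0 (\<phi> t x))"
  proof (rule solution_dist_le_abs[OF X_lipschitz, where \<gamma> = "\<lambda>s. \<phi> (t + s) x" and \<eta> = "\<lambda>s. \<phi> s (\<phi> t x)"])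
    fix s assume s: "s \<in> closed_segment 0 (- t)"
    then have "\<bar>s\<bar> < T" "\<bar>t + s\<bar> < T"
      using t by (auto simp: closed_segment_eq_real_ivl split: if_splits)
    then show "\<phi> s (\<phi> t x) \<in> UNIV \<and> ((\<lambda>s. \<phi> s (\<phi> t x)) has_vector_derivative X (\<phi> s (\<phi> t x))) (at s)"
      by (auto intro: flow_deriv)
    have "((\<lambda>s. \<phi> (t + s) x) has_vector_derivative 1 *\<^sub>R X (\<phi> (t + s) x)) (at s)"
    proof (rule vector_diff_chain_at[of "\<lambda>s. t + s" 1 s "\<lambda>s. \<phi> s x", unfolded o_def])
      show "((\<lambda>s. t + s) has_vector_derivative 1) (at s)" by (auto intro!: derivative_eq_intros)
    qed (rule flow_deriv[OF \<open>\<bar>t + s\<bar> < T\<close>])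
    then show "\<phi> (t + s) x \<in> UNIV \<and> ((\<lambda>s. \<phi> (t + s) x) has_vector_derivative X (\<phi> (t + s) x)) (at s)"
      by simp
  qed
  then show ?thesis by (simp add: flow_0)
qed

lemma flow_inverse': "\<bar>t\<bar> < T \<Longrightarrow> \<phi> t (\<phi> (- t) x) = x"
  using flow_inverse[of "- t" x] by simp

end

lemma lipschitz_flow_exists:
  fixes X :: "'a::euclidean_space \<Rightarrow> 'a"
  assumes X: "L-lipschitz_on UNIV X" and M: "\<And>x. norm (X x) \<le> M"
  obtains T \<phi> where "lipschitz_flow X L M T \<phi>"
proof -
  obtain T where T: "0 < T"
    "\<And>x. \<exists>\<gamma>. \<gamma> 0 = x \<and> (\<forall>t. \<bar>t\<bar> < T \<longrightarrow> (\<gamma> has_vector_derivative X (\<gamma> t)) (at t))"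
    using picard_lindelof_global[OF X M] by blast
  then obtain \<gamma> where "\<And>x. \<gamma> x 0 = x"
    "\<And>x t. \<bar>t\<bar> < T \<Longrightarrow> (\<gamma> x has_vector_derivative X (\<gamma> x t)) (at t)" by metis
  then have "lipschitz_flow X L M T (\<lambda>t x. \<gamma> x t)"
    using X M T by unfold_locales auto
  then show thesis by (rule that)
qed

section \<open>Volume distortion of the flow\<close>

context lipschitz_flow
begin

text \<open>It is even in \<open>t\<close>, so one factor serves a flow map and its inverse.\<close>

definition volume_distortion :: "real \<Rightarrow> real" where
  "volume_distortion t = exp (L * \<bar>t\<bar>) ^ DIM('a)"

lemma volume_distortion_ge_1: "1 \<le> volume_distortion t"
  unfolding volume_distortion_def using L_nonneg by (intro one_le_power) simp

text \<open>On the unit interval \<open>exp y \<le> 1 + y + y\<^sup>2 \<le> 1 + 2 * y\<close>, used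
  with \<open>y = DIM('a) * L * \<bar>t\<bar>\<close>.\<close>

lemma volume_distortion_le:
  assumes "DIM('a) * L * \<bar>t\<bar> \<le> 1"
  shows "volume_distortion t - 1 \<le> 2 * DIM('a) * L * \<bar>t\<bar>"
proof -
  define y where "y = DIM('a) * L * \<bar>t\<bar>"
  have y: "0 \<le> y" "y \<le> 1" using assms L_nonneg by (auto simp: y_def)
  have "volume_distortion t = exp y"
    by (simp add: volume_distortion_def y_def exp_of_nat_mult[symmetric] mult.assoc)
  also have "\<dots> \<le> 1 + y + y\<^sup>2" using y by (rule exp_bound)
  also have "y\<^sup>2 \<le> y" using y by (simp add: power2_eq_square mult_left_le)
  finally show ?thesis by (simp add: y_def mult_ac)
qed

lemma flow_measurable [measurable]: "\<bar>t\<bar> < T \<Longrightarrow> \<phi> t \<in> borel_measurable borel"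
  by (intro borel_measurable_continuous_onI flow_continuous)

lemma nn_integral_flow_le:
  assumes t: "\<bar>t\<bar> < T" and f: "f \<in> borel_measurable borel"
  shows "(\<integral>\<^sup>+x. f (\<phi> t x) \<partial>lborel) \<le> ennreal (volume_distortion t) * (\<integral>\<^sup>+x. f x \<partial>lborel)"
proof -
  have t': "\<bar>- t\<bar> < T" using t by simp
  have "emeasure (distr lborel borel (\<phi> t)) A \<le> emeasure (scale_measure (ennreal (volume_distortion t)) lborel) A"
    if "A \<in> sets borel" for A
    using emeasure_distr_le_lipschitz[OF flow_continuous[OF t] flow_lipschitz[OF t'] flow_inverse'[OF t] flow_inverse[OF t] that]
    by (simp add: volume_distortion_def)
  then have "(\<integral>\<^sup>+x. f x \<partial>distr lborel borel (\<phi> t)) \<le> (\<integral>\<^sup>+x. f x \<partial>scale_measure (ennreal (volume_distortion t)) lborel)"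
    by (intro nn_integral_mono_measure) (auto simp: le_measure)
  then show ?thesis
    using t f by (simp add: nn_integral_distr nn_integral_scale_measure)
qed

text \<open>A null set has a null preimage under the flow map, by the measure comparison applied to
  its indicator. It is what allows a function known only almost everywhere to be composed with the
  flow.\<close>

lemma AE_flow:
  assumes t: "\<bar>t\<bar> < T" and P: "AE y in lborel. P y"
  shows "AE x in lborel. P (\<phi> t x)"
proof -
  obtain N where N: "{y. \<not> P y} \<subseteq> N" "N \<in> sets borel" "emeasure lborel N = 0"
    using P unfolding eventually_ae_filter by (auto simp: null_sets_def)
  have [measurable]: "\<phi> t \<in> borel_measurable borel" using t by (rule flow_measurable)
  have "(\<integral>\<^sup>+x. indicator N (\<phi> t x) \<partial>lborel) \<le> ennreal (volume_distortion t) * (\<integral>\<^sup>+x. indicator N x \<partial>lborel)"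
    using N by (intro nn_integral_flow_le[OF t]) auto
  then have "(\<integral>\<^sup>+x. indicator N (\<phi> t x) \<partial>lborel) = 0" using N by simp
  then have "AE x in lborel. indicator N (\<phi> t x) = (0::ennreal)"
    using N(2) by (subst (asm) nn_integral_0_iff_AE) auto
  then show ?thesis
    by eventually_elim (use N(1) in \<open>auto simp: indicator_def split: if_splits\<close>)
qed

lemma integrable_flow:
  fixes g :: "'a \<Rightarrow> real"
  assumes t: "\<bar>t\<bar> < T" and g: "integrable lborel g"
  shows "integrable lborel (\<lambda>x. g (\<phi> t x))"
proof -
  have [measurable]: "g \<in> borel_measurable borel" using g by auto
  have [measurable]: "\<phi> t \<in> borel_measurable borel" using t by (rule flow_measurable)
  show ?thesis
  proof (rule integrableI_bounded)
    have "(\<integral>\<^sup>+x. ennreal (norm (g (\<phi> t x))) \<partial>lborel)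
        \<le> ennreal (volume_distortion t) * (\<integral>\<^sup>+x. ennreal (norm (g x)) \<partial>lborel)"
      by (rule nn_integral_flow_le[OF t]) auto
    also have "\<dots> < \<infinity>" using g by (auto simp: integrable_iff_bounded ennreal_mult_less_top)
    finally show "(\<integral>\<^sup>+x. ennreal (norm (g (\<phi> t x))) \<partial>lborel) < \<infinity>" .
  qed auto
qed

lemma integral_flow_nonneg_le:
  fixes h :: "'a \<Rightarrow> real"
  assumes t: "\<bar>t\<bar> < T" and h: "integrable lborel h" "\<And>x. 0 \<le> h x"
  shows "(\<integral>x. h (\<phi> t x) \<partial>lborel) \<le> volume_distortion t * (\<integral>x. h x \<partial>lborel)"
proof -
  have [measurable]: "h \<in> borel_measurable borel" using h by auto
  have "ennreal (\<integral>x. h (\<phi> t x) \<partial>lborel) = (\<integral>\<^sup>+x. ennreal (h (\<phi> t x)) \<partial>lborel)"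
    using h integrable_flow[OF t h(1)] by (simp add: nn_integral_eq_integral)
  also have "\<dots> \<le> ennreal (volume_distortion t) * (\<integral>\<^sup>+x. ennreal (h x) \<partial>lborel)"
    by (rule nn_integral_flow_le[OF t]) auto
  also have "\<dots> = ennreal (volume_distortion t * (\<integral>x. h x \<partial>lborel))"
    using h volume_distortion_ge_1[of t] by (simp add: nn_integral_eq_integral ennreal_mult')
  finally show ?thesis
    using h volume_distortion_ge_1[of t] by (subst (asm) ennreal_le_iff) (auto intro!: mult_nonneg_nonneg)
qed

lemma integral_flow_nonneg_diff:
  fixes h :: "'a \<Rightarrow> real"
  assumes t: "\<bar>t\<bar> < T" and h: "integrable lborel h" "\<And>x. 0 \<le> h x"
  shows "\<bar>(\<integral>x. h (\<phi> t x) \<partial>lborel) - (\<integral>x. h x \<partial>lborel)\<bar> \<le> (volume_distortion t - 1) * (\<integral>x. h x \<partial>lborel)"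
proof -
  define c A B where "c = volume_distortion t" and "A = (\<integral>x. h x \<partial>lborel)" and "B = (\<integral>x. h (\<phi> t x) \<partial>lborel)"
  have c: "1 \<le> c" unfolding c_def by (rule volume_distortion_ge_1)
  have BA: "B \<le> c * A" unfolding A_def B_def c_def by (rule integral_flow_nonneg_le[OF t h])
  have t': "\<bar>- t\<bar> < T" using t by simp
  \<comment> \<open>The same bound at time \<open>- t\<close>, applied to \<open>h\<close> composed
    with \<open>\<phi> t\<close>, exchanges the roles of \<open>A\<close> and
    \<open>B\<close>.\<close>
  have "A \<le> c * B"
    using integral_flow_nonneg_le[OF t' integrable_flow[OF t h(1)]] h(2)
    by (simp add: A_def B_def c_def volume_distortion_def flow_inverse'[OF t])
  \<comment> \<open>From \<open>A \<le> c * B\<close> one gets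
    \<open>A - B \<le> (c - 1) * B\<close>; this step replaces \<open>B\<close> by \<open>A\<close>
    in the bound.\<close>
  moreover have "(c - 1) * B \<le> (c - 1) * A" if "B \<le> A"
    using c that by (intro mult_left_mono) auto
  ultimately have "\<bar>B - A\<bar> \<le> (c - 1) * A"
    using BA c by (auto simp: abs_if algebra_simps)
  then show ?thesis by (simp add: A_def B_def c_def)
qed

lemma integral_flow_diff:
  fixes g :: "'a \<Rightarrow> real"
  assumes t: "\<bar>t\<bar> < T" and g: "integrable lborel g"
  shows "\<bar>(\<integral>x. g (\<phi> t x) \<partial>lborel) - (\<integral>x. g x \<partial>lborel)\<bar> \<le> (volume_distortion t - 1) * (\<integral>x. \<bar>g x\<bar> \<partial>lborel)"
proof -
  define p m where "p x = (\<bar>g x\<bar> + g x) / 2" and "m x = (\<bar>g x\<bar> - g x) / 2" for x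
  have p: "integrable lborel p" "\<And>x. 0 \<le> p x" and m: "integrable lborel m" "\<And>x. 0 \<le> m x"
    using g by (auto simp: p_def[abs_def] m_def[abs_def])
  have gpm: "g x = p x - m x" "\<bar>g x\<bar> = p x + m x" for x by (auto simp: p_def m_def field_simps)
  note ip = integrable_flow[OF t p(1)] and im = integrable_flow[OF t m(1)]
  have "\<bar>(\<integral>x. g (\<phi> t x) \<partial>lborel) - (\<integral>x. g x \<partial>lborel)\<bar>
      = \<bar>((\<integral>x. p (\<phi> t x) \<partial>lborel) - (\<integral>x. p x \<partial>lborel)) - ((\<integral>x. m (\<phi> t x) \<partial>lborel) - (\<integral>x. m x \<partial>lborel))\<bar>"
    using p m ip im by (simp add: gpm(1))
  also have "\<dots> \<le> (volume_distortion t - 1) * (\<integral>x. p x \<partial>lborel) + (volume_distortion t - 1) * (\<integral>x. m x \<partial>lborel)"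
    using integral_flow_nonneg_diff[OF t p] integral_flow_nonneg_diff[OF t m] by linarith
  also have "\<dots> = (volume_distortion t - 1) * (\<integral>x. \<bar>g x\<bar> \<partial>lborel)"
    using p m by (simp add: gpm(2) algebra_simps)
  finally show ?thesis .
qed

text \<open>Writing \<open>g (\<phi> t x) * u x\<close> as \<open>G (\<phi> t x)\<close> turns the
  change of variables into a comparison of two integrals of \<open>G\<close>, which costs the volume
  distortion times \<open>U\<close>. What remains is \<open>g\<close> against the increment of
  \<open>u\<close> along the backward flow, at most \<open>B * M * \<bar>t\<bar>\<close>. Both parts
  see \<open>g\<close> only through the integral of its absolute value.\<close>

lemma flow_difference_bound:
  fixes g u :: "'a \<Rightarrow> real"
  assumes t: "\<bar>t\<bar> < T" "DIM('a) * L * \<bar>t\<bar> \<le> 1" and g: "integrable lborel g"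
    and u: "B-lipschitz_on UNIV u" "\<And>x. \<bar>u x\<bar> \<le> U"
  shows "\<bar>\<integral>x. (g (\<phi> t x) - g x) * u x \<partial>lborel\<bar>
    \<le> (2 * DIM('a) * L * U + B * M) * \<bar>t\<bar> * (\<integral>x. \<bar>g x\<bar> \<partial>lborel)"
proof -
  have t': "\<bar>- t\<bar> < T" using t by simp
  have U: "0 \<le> U" using u(2)[of 0] by linarith
  have B: "0 \<le> B" using u(1) lipschitz_on_nonneg by blast
  have [measurable]: "u \<in> borel_measurable borel"
    by (rule borel_measurable_continuous_onI[OF lipschitz_on_continuous_on[OF u(1)]])
  have [measurable]: "\<phi> (- t) \<in> borel_measurable borel" using t' by (rule flow_measurable)
  have [measurable]: "g \<in> borel_measurable borel" using g by auto
  define G where "G y = g y * u (\<phi> (- t) y)" for y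
  have G: "integrable lborel G"
    unfolding G_def by (rule integrable_mult_bounded[OF g]) (use u in auto)
  have G\<phi>: "G (\<phi> t x) = g (\<phi> t x) * u x" for x
    by (simp add: G_def flow_inverse[OF t(1)])
  have gu: "integrable lborel (\<lambda>x. g x * u x)"
    by (rule integrable_mult_bounded[OF g]) (use u in auto)
  define N where "N = (\<integral>x. \<bar>g x\<bar> \<partial>lborel)"
  have N: "0 \<le> N" unfolding N_def by simp
  have "(\<integral>x. (g (\<phi> t x) - g x) * u x \<partial>lborel) = (\<integral>x. G (\<phi> t x) - g x * u x \<partial>lborel)"
    by (simp add: G\<phi> algebra_simps)
  also have "\<dots> = ((\<integral>x. G (\<phi> t x) \<partial>lborel) - (\<integral>x. G x \<partial>lborel)) + (\<integral>x. G x - g x * u x \<partial>lborel)"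
    using integrable_flow[OF t(1) G] G gu by simp
  finally have split: "(\<integral>x. (g (\<phi> t x) - g x) * u x \<partial>lborel) =
    ((\<integral>x. G (\<phi> t x) \<partial>lborel) - (\<integral>x. G x \<partial>lborel)) + (\<integral>x. G x - g x * u x \<partial>lborel)" .
  have "\<bar>(\<integral>x. G (\<phi> t x) \<partial>lborel) - (\<integral>x. G x \<partial>lborel)\<bar> \<le> (volume_distortion t - 1) * (\<integral>x. \<bar>G x\<bar> \<partial>lborel)"
    by (rule integral_flow_diff[OF t(1) G])
  also have "\<dots> \<le> (2 * DIM('a) * L * \<bar>t\<bar>) * (U * N)"
  proof (rule mult_mono[OF volume_distortion_le[OF t(2)]])
    have "(\<integral>x. \<bar>G x\<bar> \<partial>lborel) \<le> (\<integral>x. U * \<bar>g x\<bar> \<partial>lborel)"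
    proof (rule integral_mono)
      show "\<bar>G x\<bar> \<le> U * \<bar>g x\<bar>" for x
        using mult_left_mono[OF u(2)[of "\<phi> (- t) x"] abs_ge_zero[of "g x"]]
        by (simp add: G_def abs_mult mult.commute)
    qed (use G g in auto)
    then show "(\<integral>x. \<bar>G x\<bar> \<partial>lborel) \<le> U * N" by (simp add: N_def)
  qed (use L_nonneg in auto)
  finally have 1: "\<bar>(\<integral>x. G (\<phi> t x) \<partial>lborel) - (\<integral>x. G x \<partial>lborel)\<bar> \<le> (2 * DIM('a) * L * \<bar>t\<bar>) * (U * N)" .
  have "\<bar>\<integral>x. G x - g x * u x \<partial>lborel\<bar> \<le> (\<integral>x. \<bar>G x - g x * u x\<bar> \<partial>lborel)"
    by (rule integral_abs_bound)
  also have "\<dots> \<le> (\<integral>x. (B * M * \<bar>t\<bar>) * \<bar>g x\<bar> \<partial>lborel)"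
  proof (rule integral_mono)
    fix x
    have "\<bar>u (\<phi> (- t) x) - u x\<bar> \<le> B * norm (\<phi> (- t) x - x)"
      using lipschitz_on_normD[OF u(1)] by auto
    also have "\<dots> \<le> B * (M * \<bar>- t\<bar>)" by (intro mult_left_mono flow_dist t' B)
    finally have "\<bar>g x\<bar> * \<bar>u (\<phi> (- t) x) - u x\<bar> \<le> \<bar>g x\<bar> * (B * (M * \<bar>- t\<bar>))" by (intro mult_left_mono) auto
    moreover have "\<bar>G x - g x * u x\<bar> = \<bar>g x\<bar> * \<bar>u (\<phi> (- t) x) - u x\<bar>"
      by (simp add: G_def abs_mult[symmetric] algebra_simps)
    ultimately show "\<bar>G x - g x * u x\<bar> \<le> (B * M * \<bar>t\<bar>) * \<bar>g x\<bar>" by (simp add: mult_ac)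
  qed (use G gu g in auto)
  also have "\<dots> = (B * M * \<bar>t\<bar>) * N" by (simp add: N_def)
  finally have 2: "\<bar>\<integral>x. G x - g x * u x \<partial>lborel\<bar> \<le> (B * M * \<bar>t\<bar>) * N" .
  have "\<bar>\<integral>x. (g (\<phi> t x) - g x) * u x \<partial>lborel\<bar> \<le> (2 * DIM('a) * L * \<bar>t\<bar>) * (U * N) + (B * M * \<bar>t\<bar>) * N"
    unfolding split using 1 2 by linarith
  also have "\<dots> = (2 * DIM('a) * L * U + B * M) * \<bar>t\<bar> * N" by (simp add: algebra_simps)
  finally show ?thesis by (simp add: N_def)
qed

end

subsection \<open>Lipschitz functions and polynomials\<close>

lemma lipschitz_on_mult_bounded:
  fixes f :: "'a::metric_space \<Rightarrow> real" and g :: "'a \<Rightarrow> 'b::real_normed_vector"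
  assumes f: "C-lipschitz_on S f" "\<And>x. x \<in> S \<Longrightarrow> \<bar>f x\<bar> \<le> A"
    and g: "D-lipschitz_on S g" "\<And>x. x \<in> S \<Longrightarrow> norm (g x) \<le> B"
    and "0 \<le> A" "0 \<le> B"
  shows "(A * D + C * B)-lipschitz_on S (\<lambda>x. f x *\<^sub>R g x)"
proof (rule lipschitz_onI)
  fix x y assume xy: "x \<in> S" "y \<in> S"
  have "f x *\<^sub>R g x - f y *\<^sub>R g y = f x *\<^sub>R (g x - g y) + (f x - f y) *\<^sub>R g y"
    by (simp add: algebra_simps)
  then have "norm (f x *\<^sub>R g x - f y *\<^sub>R g y) \<le> \<bar>f x\<bar> * norm (g x - g y) + \<bar>f x - f y\<bar> * norm (g y)"
    by (metis norm_triangle_ineq norm_scaleR)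
  also have "\<dots> \<le> A * (D * dist x y) + (C * dist x y) * B"
    using lipschitz_onD[OF f(1) xy] lipschitz_onD[OF g(1) xy] f(2)[OF xy(1)] g(2)[OF xy(2)]
      assms(5,6) lipschitz_on_nonneg[OF f(1)]
    by (intro add_mono mult_mono) (auto simp: dist_norm dist_real_def)
  finally show "dist (f x *\<^sub>R g x) (f y *\<^sub>R g y) \<le> (A * D + C * B) * dist x y"
    by (simp add: dist_norm algebra_simps)
qed (use assms lipschitz_on_nonneg[OF f(1)] lipschitz_on_nonneg[OF g(1)] in auto)

text \<open>A point of \<open>S\<close> and a point outside \<open>N\<close> are at least
  \<open>d\<close> apart, so the bound \<open>B\<close> is itself at most \<open>B / d\<close> times
  their distance. It provides global Lipschitz constants for the cutoff field, for the extension of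
  \<open>u\<close> and for products with polynomials.\<close>

lemma lipschitz_on_zero_extension:
  fixes w :: "'a::metric_space \<Rightarrow> 'b::real_normed_vector"
  assumes w: "C-lipschitz_on N w" and B: "\<And>x. x \<in> N \<Longrightarrow> norm (w x) \<le> B" "0 \<le> B"
    and S: "\<And>x. x \<in> S \<Longrightarrow> ball x d \<subseteq> N" "0 < d" and zero: "\<And>x. x \<notin> S \<Longrightarrow> w x = 0"
  shows "(C + B / d)-lipschitz_on UNIV w"
proof (rule lipschitz_onI)
  have C: "0 \<le> C" using w lipschitz_on_nonneg by blast
  have one: "norm (w x) \<le> (C + B / d) * dist x y" if "x \<in> S" "y \<notin> N" for x y
  proof -
    have "d \<le> dist x y" using S(1)[OF that(1)] that(2) by (auto simp: subset_iff not_less[symmetric])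
    then have "B * 1 \<le> B * (dist x y / d)" using B(2) S(2) by (intro mult_left_mono) auto
    moreover have "x \<in> N" using S that by force
    ultimately have "norm (w x) \<le> B / d * dist x y" using B(1)[of x] by simp
    also have "\<dots> \<le> (C + B / d) * dist x y" using C by (intro mult_right_mono) auto
    finally show ?thesis .
  qed
  fix x y
  consider "x \<in> N" "y \<in> N" | "x \<in> S" "y \<notin> N" | "x \<notin> N" "y \<in> S" | "x \<notin> S" "y \<notin> S"
    using S by force
  then show "dist (w x) (w y) \<le> (C + B / d) * dist x y"
  proof cases
    case 1
    then have "dist (w x) (w y) \<le> C * dist x y" using w by (auto intro: lipschitz_onD)
    also have "\<dots> \<le> (C + B / d) * dist x y" using B S by (intro mult_right_mono) auto
    finally show ?thesis .
  next
    case 2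
    then have "w y = 0" using S zero by (metis centre_in_ball subsetD)
    then show ?thesis using one[OF 2] by simp
  next
    case 3
    then have "w x = 0" using S zero by (metis centre_in_ball subsetD)
    then show ?thesis using one[OF 3(2,1)] by (simp add: dist_commute)
  next
    case 4
    then show ?thesis using zero B S C by simp
  qed
qed (use B S lipschitz_on_nonneg[OF w] in auto)

lemma real_polynomial_function_continuous_on: "real_polynomial_function p \<Longrightarrow> continuous_on S p"
  by (simp add: continuous_on_polymonial_function real_polynomial_function_eq)

text \<open>The Lipschitz constant of a product involves bounds of its factors, so the induction has
  to carry both.\<close>

lemma real_polynomial_function_lipschitz:
  fixes p :: "'a::real_normed_vector \<Rightarrow> real"
  assumes "real_polynomial_function p" and "bounded S"
  shows "\<exists>B C. 0 \<le> B \<and> (\<forall>x\<in>S. \<bar>p x\<bar> \<le> B) \<and> C-lipschitz_on S p"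
  using assms(1)
proof induction
  case (linear f)
  obtain K where K: "0 < K" "\<And>x. norm (f x) \<le> norm x * K" using bounded_linear.pos_bounded[OF linear] by auto
  obtain R where R: "0 < R" "\<And>x. x \<in> S \<Longrightarrow> norm x \<le> R" using assms(2) bounded_pos by blast
  have "\<bar>f x\<bar> \<le> R * K" if "x \<in> S" for x
  proof -
    have "\<bar>f x\<bar> \<le> norm x * K" using K(2)[of x] by simp
    also have "\<dots> \<le> R * K" using R(2)[OF that] K(1) by (intro mult_right_mono) auto
    finally show ?thesis .
  qed
  moreover have "K-lipschitz_on S f"
  proof (rule lipschitz_onI)
    fix x y
    have "f x - f y = f (x - y)" using linear by (simp add: bounded_linear.linear linear_diff)
    then show "dist (f x) (f y) \<le> K * dist x y" using K(2)[of "x - y"] by (simp add: dist_norm mult.commute)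
  qed (use K in simp)
  ultimately show ?case using K R by (metis less_imp_le mult_nonneg_nonneg)
next
  case (const c)
  then show ?case using lipschitz_on_constant[of S c] by (intro exI[of _ "\<bar>c\<bar>"] exI[of _ 0]) auto
next
  case (add f g)
  then obtain B1 C1 B2 C2 where *: "0 \<le> B1" "\<forall>x\<in>S. \<bar>f x\<bar> \<le> B1" "C1-lipschitz_on S f"
    "0 \<le> B2" "\<forall>x\<in>S. \<bar>g x\<bar> \<le> B2" "C2-lipschitz_on S g" by blast
  have "\<bar>f x + g x\<bar> \<le> B1 + B2" if "x \<in> S" for x
    using * that abs_triangle_ineq[of "f x" "g x"] by fastforce
  then show ?case using * lipschitz_on_add[OF *(3,6)] by (intro exI[of _ "B1 + B2"] exI[of _ "C1 + C2"]) auto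
next
  case (mult f g)
  then obtain B1 C1 B2 C2 where *: "0 \<le> B1" "\<forall>x\<in>S. \<bar>f x\<bar> \<le> B1" "C1-lipschitz_on S f"
    "0 \<le> B2" "\<forall>x\<in>S. \<bar>g x\<bar> \<le> B2" "C2-lipschitz_on S g" by blast
  have "\<bar>f x * g x\<bar> \<le> B1 * B2" if "x \<in> S" for x
    using * that by (simp add: abs_mult mult_mono)
  moreover have "(B1 * C2 + C1 * B2)-lipschitz_on S (\<lambda>x. f x * g x)"
    using lipschitz_on_mult_bounded[OF *(3) _ *(6), of B1 B2] * by auto
  ultimately show ?case using * by (metis mult_nonneg_nonneg)
qed

section \<open>Density of polynomials on balls\<close>

lemma continuous_integrable_cball:
  fixes p :: "'a::euclidean_space \<Rightarrow> real"
  assumes "continuous_on UNIV p"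
  shows "integrable lborel (\<lambda>x. indicator (cball 0 R) x * p x)"
proof -
  have [measurable]: "p \<in> borel_measurable borel" using assms by (rule borel_measurable_continuous_onI)
  have "bounded (p ` cball 0 R)"
    by (intro compact_imp_bounded compact_continuous_image continuous_on_subset[OF assms]) auto
  then obtain B where "\<forall>y\<in>p ` cball 0 R. \<bar>y\<bar> \<le> B" unfolding bounded_real by blast
  then have "\<bar>indicator (cball 0 R) x * p x\<bar> \<le> max B 0" for x
    by (cases "x \<in> cball 0 R") force+
  moreover have "(\<lambda>x. indicator (cball 0 R) x * p x) \<in> borel_measurable borel"
    by (intro borel_measurable_times borel_measurable_indicator) auto
  ultimately show ?thesis
    by (intro integrable_bounded_support[of _ "max B 0" R]) auto
qed

text \<open>Urysohn's function between a closed \<open>F\<close> inside \<open>A\<close> and an open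
  \<open>G\<close> around \<open>A\<close> differs from the indicator only on \<open>G - F\<close>,
  and there by at most 1.\<close>

lemma indicator_approx_continuous:
  fixes A :: "'a::euclidean_space set"
  assumes A: "A \<in> sets borel" and e: "0 < e"
  obtains v V where "continuous_on UNIV (v :: 'a \<Rightarrow> real)" "V \<in> sets borel" "emeasure lborel V \<le> ennreal e"
    "\<And>x. \<bar>indicator A x - v x\<bar> \<le> indicator V x"
proof -
  have Al: "A \<in> sets lebesgue" using A by auto
  obtain G where G: "open G" "A \<subseteq> G" "emeasure lebesgue (G - A) < ennreal (e/2)"
    using sets_lebesgue_outer_open[OF Al, of "e/2"] e by (metis half_gt_zero)
  obtain F where F: "closed F" "F \<subseteq> A" "emeasure lebesgue (A - F) < ennreal (e/2)"
    using sets_lebesgue_inner_closed[OF Al, of "e/2"] e by (metis half_gt_zero)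
  obtain v where v: "continuous_on UNIV v" "\<And>x. v x \<in> closed_segment 1 (0::real)"
    "\<And>x. x \<in> F \<Longrightarrow> v x = 1" "\<And>x. x \<in> - G \<Longrightarrow> v x = 0"
    by (rule Urysohn[of F "- G" 1 "0::real"]) (use F G in auto)
  define V where "V = (G - A) \<union> (A - F)"
  have GA: "G - A \<in> sets borel" "A - F \<in> sets borel" using A F G by auto
  show thesis
  proof (rule that[OF v(1)])
    show "V \<in> sets borel" using GA by (auto simp: V_def)
    have "emeasure lborel V \<le> emeasure lborel (G - A) + emeasure lborel (A - F)"
      unfolding V_def using GA by (intro emeasure_subadditive) auto
    also have "\<dots> \<le> ennreal (e/2) + ennreal (e/2)"
      using F(3) G(3) GA by (intro add_mono) auto
    also have "\<dots> = ennreal e" using e by (simp add: ennreal_plus[symmetric] del: ennreal_plus)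
    finally show "emeasure lborel V \<le> ennreal e" .
    show "\<bar>indicator A x - v x\<bar> \<le> indicator V x" for x
      using v(2)[of x] v(3)[of x] v(4)[of x] F(2) G(2)
      by (auto simp: V_def indicator_def closed_segment_eq_real_ivl)
  qed
qed

lemma integrable_indicator_cball_mult:
  fixes h :: "'a::euclidean_space \<Rightarrow> real"
  assumes "integrable lborel h"
  shows "integrable lborel (\<lambda>x. indicator (cball 0 R) x * h x)"
  using integrable_real_mult_indicator[OF _ assms, of "cball 0 R"] by (simp add: mult.commute)

lemma integrable_cball_polynomial_diff:
  fixes h p :: "'a::euclidean_space \<Rightarrow> real"
  assumes h: "integrable lborel h" and p: "real_polynomial_function p"
  shows "integrable lborel (\<lambda>x. indicator (cball 0 R) x * \<bar>h x - p x\<bar>)"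
proof -
  have "integrable lborel (\<lambda>x. indicator (cball 0 R) x * h x - indicator (cball 0 R) x * p x)"
    by (intro Bochner_Integration.integrable_diff integrable_indicator_cball_mult h
      continuous_integrable_cball real_polynomial_function_continuous_on p)
  then have "integrable lborel (\<lambda>x. \<bar>indicator (cball 0 R) x * h x - indicator (cball 0 R) x * p x\<bar>)" by simp
  then show ?thesis by (simp add: right_diff_distrib[symmetric] abs_mult)
qed

lemma polynomial_L1_dense_on_cball:
  fixes g :: "'a::euclidean_space \<Rightarrow> real"
  assumes "integrable lborel g" "0 < e"
  shows "\<exists>p. real_polynomial_function p \<and> (\<integral>x. indicator (cball 0 R) x * \<bar>g x - p x\<bar> \<partial>lborel) < e"
  using assms
proof (induction arbitrary: e rule: integrable_induct)
  case (base A c)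
  let ?K = "cball 0 R :: 'a set"
  define m where "m = measure lborel ?K"
  \<comment> \<open>The total error is \<open>\<bar>c\<bar> * d\<close> from the exceptional set
    \<open>V\<close> plus \<open>d * m\<close> from the uniform approximation on the ball; the added
    1 makes the estimate strict and the denominator positive.\<close>
  define d where "d = e / (\<bar>c\<bar> + m + 1)"
  have pos: "0 < \<bar>c\<bar> + m + 1" by (simp add: m_def add_nonneg_pos)
  then have d: "0 < d" using \<open>0 < e\<close> by (simp add: d_def)
  have A: "A \<in> sets borel" using base by simp
  obtain v V where v: "continuous_on UNIV (v :: 'a \<Rightarrow> real)" and V: "V \<in> sets borel" "emeasure lborel V \<le> ennreal d"
    "\<And>x. \<bar>indicator A x - v x\<bar> \<le> indicator V x" using indicator_approx_continuous[OF A d] by blast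
  obtain p where p: "real_polynomial_function p" "\<And>x. x \<in> ?K \<Longrightarrow> \<bar>c * v x - p x\<bar> < d"
    using Stone_Weierstrass_real_polynomial_function[of ?K "\<lambda>x. c * v x" d] d v
    by (metis compact_cball continuous_on_mult_left continuous_on_subset subset_UNIV)
  have Vfin: "emeasure lborel V < \<infinity>" using V(2) by (rule le_less_trans) simp
  have Kfin: "emeasure lborel ?K < \<infinity>" by (rule emeasure_bounded_finite) simp
  have "measure lborel V \<le> d" using V(2) d by (simp add: measure_def enn2real_leI)
  have "(\<integral>x. indicator ?K x * \<bar>indicator A x *\<^sub>R c - p x\<bar> \<partial>lborel)
      \<le> (\<integral>x. \<bar>c\<bar> * indicator V x + d * indicator ?K x \<partial>lborel)"
  proof (rule integral_mono')
    show "integrable lborel (\<lambda>x. \<bar>c\<bar> * indicator V x + d * indicator ?K x)"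
      using V(1) Vfin Kfin by (intro Bochner_Integration.integrable_add integrable_mult_right integrable_real_indicator) auto
    fix x :: 'a
    show "indicator ?K x * \<bar>indicator A x *\<^sub>R c - p x\<bar> \<le> \<bar>c\<bar> * indicator V x + d * indicator ?K x"
    proof (cases "x \<in> ?K")
      case True
      have "indicator A x *\<^sub>R c - p x = c * (indicator A x - v x) + (c * v x - p x)" by (simp add: algebra_simps)
      then have "\<bar>indicator A x *\<^sub>R c - p x\<bar> \<le> \<bar>c\<bar> * \<bar>indicator A x - v x\<bar> + \<bar>c * v x - p x\<bar>"
        by (metis abs_mult abs_triangle_ineq)
      also have "\<dots> \<le> \<bar>c\<bar> * indicator V x + d"
        using p(2)[OF True] V(3)[of x] by (intro add_mono mult_left_mono) auto
      finally show ?thesis using True by simp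
    qed simp
    show "0 \<le> \<bar>c\<bar> * indicator V x + d * indicator ?K x" using d by simp
  qed
  also have "\<dots> = \<bar>c\<bar> * measure lborel V + d * m"
    using V(1) Vfin Kfin by (subst Bochner_Integration.integral_add) (auto simp: m_def intro!: integrable_mult_right integrable_real_indicator)
  also have "\<dots> \<le> \<bar>c\<bar> * d + d * m" using \<open>measure lborel V \<le> d\<close> by (intro add_right_mono mult_left_mono) auto
  also have "\<dots> < d * (\<bar>c\<bar> + m + 1)" using d by (simp add: algebra_simps)
  also have "\<dots> = e" using pos by (simp add: d_def)
  finally show ?case using p(1) by blast
next
  case (add f g)
  obtain p where p: "real_polynomial_function p" "(\<integral>x. indicator (cball 0 R) x * \<bar>f x - p x\<bar> \<partial>lborel) < e/2"
    using add.IH(1)[of "e/2"] add.prems by auto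
  obtain q where q: "real_polynomial_function q" "(\<integral>x. indicator (cball 0 R) x * \<bar>g x - q x\<bar> \<partial>lborel) < e/2"
    using add.IH(2)[of "e/2"] add.prems by auto
  have "(\<integral>x. indicator (cball 0 R) x * \<bar>f x + g x - (p x + q x)\<bar> \<partial>lborel)
      \<le> (\<integral>x. indicator (cball 0 R) x * \<bar>f x - p x\<bar> + indicator (cball 0 R) x * \<bar>g x - q x\<bar> \<partial>lborel)"
    by (rule integral_mono')
      (use integrable_cball_polynomial_diff[OF add.hyps(1) p(1)] integrable_cball_polynomial_diff[OF add.hyps(2) q(1)] in \<open>auto simp: indicator_def\<close>)
  also have "\<dots> < e"
    using integrable_cball_polynomial_diff[OF add.hyps(1) p(1)] integrable_cball_polynomial_diff[OF add.hyps(2) q(1)] p(2) q(2) by simp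
  finally show ?case using p(1) q(1) by (intro exI[of _ "\<lambda>x. p x + q x"]) auto
next
  case (lim f s)
  have "(\<lambda>i. \<integral>x. \<bar>f x - s i x\<bar> \<partial>lborel) \<longlonglongrightarrow> (\<integral>x. 0 \<partial>(lborel :: 'a measure))"
  \<comment> \<open>The induction rule supplies
    \<open>\<bar>s i x\<bar> \<le> 2 * \<bar>f x\<bar>\<close>, whence the factor 3.\<close>
  proof (rule integral_dominated_convergence[where w = "\<lambda>x. 3 * \<bar>f x\<bar>"])
    show "AE x in lborel. (\<lambda>i. \<bar>f x - s i x\<bar>) \<longlonglongrightarrow> 0"
    proof (rule AE_I2)
      fix x :: 'a
      have "(\<lambda>i. \<bar>f x - s i x\<bar>) \<longlonglongrightarrow> \<bar>f x - f x\<bar>"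
        using lim.hyps(2)[of x] by (intro tendsto_intros) auto
      then show "(\<lambda>i. \<bar>f x - s i x\<bar>) \<longlonglongrightarrow> 0" by simp
    qed
    show "AE x in lborel. norm \<bar>f x - s i x\<bar> \<le> 3 * \<bar>f x\<bar>" for i
    proof (rule AE_I2)
      fix x :: 'a
      show "norm \<bar>f x - s i x\<bar> \<le> 3 * \<bar>f x\<bar>" using lim.hyps(3)[of x i] by auto
    qed
  qed (use lim.hyps in auto)
  then have "eventually (\<lambda>i. (\<integral>x. \<bar>f x - s i x\<bar> \<partial>lborel) < e/2) sequentially"
    using lim.prems by (intro order_tendstoD) auto
  then obtain i where i: "(\<integral>x. \<bar>f x - s i x\<bar> \<partial>lborel) < e/2" by (auto simp: eventually_sequentially)
  obtain p where p: "real_polynomial_function p" "(\<integral>x. indicator (cball 0 R) x * \<bar>s i x - p x\<bar> \<partial>lborel) < e/2"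
    using lim.IH[of "e/2" i] lim.prems by auto
  note int = integrable_cball_polynomial_diff[OF lim.hyps(1)[of i] p(1), of R]
  have int2: "integrable lborel (\<lambda>x. \<bar>f x - s i x\<bar>)" using lim.hyps by auto
  have "(\<integral>x. indicator (cball 0 R) x * \<bar>f x - p x\<bar> \<partial>lborel)
      \<le> (\<integral>x. \<bar>f x - s i x\<bar> + indicator (cball 0 R) x * \<bar>s i x - p x\<bar> \<partial>lborel)"
    by (rule integral_mono') (use int int2 in \<open>auto simp: indicator_def\<close>)
  also have "\<dots> < e" using int int2 i p(2) by simp
  finally show ?case using p(1) by blast
qed

subsection \<open>The limit of the difference quotients along a flow\<close>

text \<open>\<open>DX e\<close> differentiates the \<open>e\<close>-component in direction
  \<open>e\<close>, so only the terms that make up the divergence occur. The derivatives enter as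
  Borel functions agreeing almost everywhere with the true ones, which makes them ready for
  integration.\<close>

locale lipschitz_flow_test = lipschitz_flow X L M T \<phi>
  for X :: "'a::euclidean_space \<Rightarrow> 'a" and L M T \<phi> +
  fixes u :: "'a \<Rightarrow> real" and B U R :: real and DU DX :: "'a \<Rightarrow> 'a \<Rightarrow> real"
  assumes u_lipschitz: "B-lipschitz_on UNIV u" and u_bound: "\<And>x. \<bar>u x\<bar> \<le> U"
    and u_support: "\<And>x. x \<notin> cball 0 R \<Longrightarrow> u x = 0"
    and DU_borel: "\<And>e. e \<in> Basis \<Longrightarrow> DU e \<in> borel_measurable borel"
    and DX_borel: "\<And>e. e \<in> Basis \<Longrightarrow> DX e \<in> borel_measurable borel"
    and DU_deriv: "\<And>e. e \<in> Basis \<Longrightarrow>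
      AE x in lborel. ((\<lambda>s. u (x + s *\<^sub>R e)) has_field_derivative DU e x) (at 0)"
    and DX_deriv: "\<And>e. e \<in> Basis \<Longrightarrow>
      AE x in lborel. ((\<lambda>s. X (x + s *\<^sub>R e) \<bullet> e) has_field_derivative DX e x) (at 0)"
begin

text \<open>Formally the negative divergence of \<open>u\<close> times \<open>X\<close>, that is,
  the adjoint of differentiation along \<open>X\<close> applied to \<open>u\<close>; it merges the
  two integrals of the claimed limit into one.\<close>

definition weight :: "'a \<Rightarrow> real" where
  "weight x = - (\<Sum>e\<in>Basis. (X x \<bullet> e) * DU e x) - u x * (\<Sum>e\<in>Basis. DX e x)"

definition mean_quotient :: "('a \<Rightarrow> real) \<Rightarrow> real \<Rightarrow> real" where
  "mean_quotient g t = (\<integral>x. (g (\<phi> t x) - g x) / t * u x \<partial>lborel)"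

lemma X_continuous: "continuous_on UNIV X"
  by (rule lipschitz_on_continuous_on[OF X_lipschitz])

lemma X_measurable [measurable]: "X \<in> borel_measurable borel"
  by (rule borel_measurable_continuous_onI[OF X_continuous])

lemma u_measurable [measurable]: "u \<in> borel_measurable borel"
  by (rule borel_measurable_continuous_onI[OF lipschitz_on_continuous_on[OF u_lipschitz]])

lemma U_nonneg: "0 \<le> U" using u_bound[of 0] by linarith

lemma B_nonneg: "0 \<le> B" using u_lipschitz lipschitz_on_nonneg by blast

lemma X_component_lipschitz: "e \<in> Basis \<Longrightarrow> L-lipschitz_on UNIV (\<lambda>x. X x \<bullet> e)"
  by (rule lipschitz_on_inner_Basis[OF X_lipschitz])

lemma X_component_bound: "e \<in> Basis \<Longrightarrow> \<bar>X x \<bullet> e\<bar> \<le> M"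
  using Basis_le_norm[of e "X x"] X_bound[of x] by linarith

lemma weight_measurable [measurable]: "weight \<in> borel_measurable borel"
proof -
  have "(\<lambda>x. (X x \<bullet> e) * DU e x) \<in> borel_measurable borel" if "e \<in> Basis" for e
    using DU_borel[OF that] by measurable
  then show ?thesis
    unfolding weight_def using DX_borel by measurable
qed

lemma AE_derivative_bounds:
  "AE x in lborel. \<bar>\<Sum>e\<in>Basis. (X x \<bullet> e) * DU e x\<bar> \<le> DIM('a) * (M * B) \<and>
     \<bar>u x * (\<Sum>e\<in>Basis. DX e x)\<bar> \<le> DIM('a) * (U * L) \<and>
     (x \<notin> cball 0 R \<longrightarrow> weight x = 0)"
proof -
  have "AE x in lborel. \<forall>e\<in>Basis. ((\<lambda>s. u (x + s *\<^sub>R e)) has_field_derivative DU e x) (at 0) \<and>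
      ((\<lambda>s. X (x + s *\<^sub>R e) \<bullet> e) has_field_derivative DX e x) (at 0)"
    using DU_deriv DX_deriv by (intro AE_finite_allI) auto
  then show ?thesis
  proof eventually_elim
    case (elim x)
    have DU: "\<bar>DU e x\<bar> \<le> B" and DX: "\<bar>DX e x\<bar> \<le> L" if "e \<in> Basis" for e
      using elim that directional_derivative_le_lipschitz[OF u_lipschitz, of x e]
        directional_derivative_le_lipschitz[OF X_component_lipschitz[OF that], of x e] by auto
    have 1: "\<bar>\<Sum>e\<in>Basis. (X x \<bullet> e) * DU e x\<bar> \<le> (\<Sum>e\<in>(Basis::'a set). M * B)"
      using DU X_component_bound M_nonneg
      by (intro order_trans[OF sum_abs sum_mono]) (auto simp: abs_mult intro!: mult_mono)
    have "\<bar>\<Sum>e\<in>Basis. DX e x\<bar> \<le> (\<Sum>e\<in>(Basis::'a set). L)"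
      using DX by (intro order_trans[OF sum_abs sum_mono])
    then have 2: "\<bar>u x\<bar> * \<bar>\<Sum>e\<in>Basis. DX e x\<bar> \<le> U * (\<Sum>e\<in>(Basis::'a set). L)"
      using u_bound[of x] U_nonneg by (intro mult_mono) auto
    \<comment> \<open>Here \<open>u\<close> vanishes near \<open>x\<close>, hence so do its
      derivatives. \<open>DX e x\<close> may be nonzero, but it is multiplied by
      \<open>u x\<close>.\<close>
    have "weight x = 0" if x: "x \<notin> cball 0 R"
    proof -
      have "DU e x = 0" if e: "e \<in> Basis" for e
        by (rule directional_derivative_eq_0[OF closed_cball x u_support]) (use elim e in blast)+
      then show ?thesis using u_support[OF x] by (simp add: weight_def)
    qed
    then show ?case using 1 2 by (simp add: abs_mult mult_ac)
  qed
qed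

lemma AE_weight_bound:
  "AE x in lborel. \<bar>weight x\<bar> \<le> DIM('a) * (M * B + U * L) \<and> (x \<notin> cball 0 R \<longrightarrow> weight x = 0)"
  using AE_derivative_bounds
proof eventually_elim
  case (elim x)
  then have "\<bar>weight x\<bar> \<le> DIM('a) * (M * B) + DIM('a) * (U * L)"
    unfolding weight_def by linarith
  then show ?case using elim by (simp add: distrib_left)
qed

lemma integrable_mult_weight: "integrable lborel g \<Longrightarrow> integrable lborel (\<lambda>x. g x * weight x)"
  and integral_mult_weight_le: "integrable lborel g \<Longrightarrow>
    \<bar>\<integral>x. g x * weight x \<partial>lborel\<bar> \<le> DIM('a) * (M * B + U * L) * (\<integral>x. \<bar>g x\<bar> \<partial>lborel)"
proof -
  assume g: "integrable lborel g"
  have "AE x in lborel. \<bar>weight x\<bar> \<le> DIM('a) * (M * B + U * L)"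
    using AE_weight_bound by eventually_elim simp
  note * = integrable_mult_AE_bounded[OF g weight_measurable this]
  show "integrable lborel (\<lambda>x. g x * weight x)"
    "\<bar>\<integral>x. g x * weight x \<partial>lborel\<bar> \<le> DIM('a) * (M * B + U * L) * (\<integral>x. \<bar>g x\<bar> \<partial>lborel)"
    using * by simp_all
qed

lemma integrable_mult_derivatives:
  assumes g: "integrable lborel g"
  shows "integrable lborel (\<lambda>x. g x * (\<Sum>e\<in>Basis. (X x \<bullet> e) * DU e x))"
    and "integrable lborel (\<lambda>x. g x * (u x * (\<Sum>e\<in>Basis. DX e x)))"
proof -
  have "(\<lambda>x. (X x \<bullet> e) * DU e x) \<in> borel_measurable borel" if "e \<in> Basis" for e
    using DU_borel[OF that] by measurable
  then have "(\<lambda>x. \<Sum>e\<in>Basis. (X x \<bullet> e) * DU e x) \<in> borel_measurable borel" by measurable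
  moreover have "AE x in lborel. \<bar>\<Sum>e\<in>Basis. (X x \<bullet> e) * DU e x\<bar> \<le> DIM('a) * (M * B)"
    using AE_derivative_bounds by eventually_elim simp
  ultimately show "integrable lborel (\<lambda>x. g x * (\<Sum>e\<in>Basis. (X x \<bullet> e) * DU e x))"
    by (rule integrable_mult_AE_bounded(1)[OF g])
  have "(\<lambda>x. u x * (\<Sum>e\<in>Basis. DX e x)) \<in> borel_measurable borel" using DX_borel by measurable
  moreover have "AE x in lborel. \<bar>u x * (\<Sum>e\<in>Basis. DX e x)\<bar> \<le> DIM('a) * (U * L)"
    using AE_derivative_bounds by eventually_elim simp
  ultimately show "integrable lborel (\<lambda>x. g x * (u x * (\<Sum>e\<in>Basis. DX e x)))"
    by (rule integrable_mult_AE_bounded(1)[OF g])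
qed

text \<open>By Leibniz's rule the derivatives of \<open>p * u * (X \<bullet> e)\<close> in direction
  \<open>e\<close>, summed over the basis, give \<open>Dp x (X x) * u x - p x * weight x\<close>
  almost everywhere, and their integrals vanish. \<open>E\<close> is assembled from the Borel
  derivatives and \<open>weight\<close>, so it is a Borel version of
  \<open>Dp x (X x) * u x\<close>.\<close>

lemma polynomial_integration_by_parts:
  assumes p: "real_polynomial_function p" and Dp: "\<And>x. (p has_derivative Dp x) (at x)"
  obtains E where "E \<in> borel_measurable borel" "integrable lborel E"
    "(\<integral>x. E x \<partial>lborel) = (\<integral>x. indicator (cball 0 (R + 1)) x * p x * weight x \<partial>lborel)"
    "AE x in lborel. E x = Dp x (X x) * u x"
proof -
  let ?K = "cball 0 (R + 1) :: 'a set"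
  obtain Bp Cp where Bp: "0 \<le> Bp" "\<forall>x\<in>?K. \<bar>p x\<bar> \<le> Bp" and Cp: "Cp-lipschitz_on ?K p"
    using real_polynomial_function_lipschitz[OF p, of ?K] by auto
  define good where "good e D \<longleftrightarrow> D \<in> borel_measurable borel \<and> integrable lborel D \<and> (\<integral>x. D x \<partial>lborel) = 0 \<and>
      (AE x in lborel. ((\<lambda>s. p (x + s *\<^sub>R e) * (u (x + s *\<^sub>R e) * (X (x + s *\<^sub>R e) \<bullet> e)))
        has_field_derivative D x) (at 0))" for e D
  have "\<exists>D. good e D" if e: "e \<in> Basis" for e
  proof -
    define w where "w x = p x * (u x * (X x \<bullet> e))" for x
    have "(U * L + B * M)-lipschitz_on UNIV (\<lambda>x. u x * (X x \<bullet> e))"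
      using lipschitz_on_mult_bounded[OF u_lipschitz _ X_component_lipschitz[OF e], of U M]
        u_bound X_component_bound[OF e] U_nonneg M_nonneg by simp
    then have uX: "(U * L + B * M)-lipschitz_on ?K (\<lambda>x. u x * (X x \<bullet> e))"
      by (rule lipschitz_on_subset) auto
    have uX_bound: "\<bar>u x * (X x \<bullet> e)\<bar> \<le> U * M" for x
      using u_bound[of x] X_component_bound[OF e, of x] U_nonneg by (simp add: abs_mult mult_mono)
    have "(Bp * (U * L + B * M) + Cp * (U * M))-lipschitz_on ?K w"
      unfolding w_def
      using lipschitz_on_mult_bounded[OF Cp _ uX, of Bp "U * M"] Bp uX_bound U_nonneg M_nonneg by simp
    moreover have "norm (w x) \<le> Bp * (U * M)" if "x \<in> ?K" for x
      using uX_bound[of x] Bp(2)[rule_format, OF that] Bp(1) by (simp add: w_def abs_mult[of "p x"] mult_mono)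
    ultimately have "\<exists>C. C-lipschitz_on UNIV w"
    \<comment> \<open>Bounds for a polynomial hold only on bounded sets; the margin 1 between the
      radii \<open>R\<close> and \<open>R + 1\<close> lets the zero extension make the product
      globally Lipschitz.\<close>
    proof (intro exI, rule lipschitz_on_zero_extension[where S = "cball 0 R" and N = ?K and d = 1])
      show "ball x 1 \<subseteq> ?K" if "x \<in> cball 0 R" for x :: 'a
      proof
        fix y assume "y \<in> ball x 1"
        then show "y \<in> ?K" using that norm_triangle_ineq2[of y x] by (auto simp: dist_norm norm_minus_commute)
      qed
      show "w x = 0" if "x \<notin> cball 0 R" for x using u_support[OF that] by (simp add: w_def)
    qed (use Bp U_nonneg M_nonneg in auto)
    then obtain C where w: "C-lipschitz_on UNIV w" by blast
    have w0: "w x = 0" if "x \<notin> cball 0 R" for x using u_support[OF that] by (simp add: w_def)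
    obtain D where D: "D \<in> borel_measurable borel"
      "AE x in lborel. ((\<lambda>s. w (x + s *\<^sub>R e)) has_field_derivative D x) (at 0)"
      using lipschitz_borel_directional_derivative[OF w] by blast
    show ?thesis
      using D integral_directional_derivative[OF w w0 D] unfolding w_def good_def by blast
  qed
  then obtain D where "\<forall>e\<in>Basis. good e (D e)" using bchoice[of Basis good] by blast
  then have D: "\<And>e. e \<in> Basis \<Longrightarrow> D e \<in> borel_measurable borel \<and> integrable lborel (D e) \<and>
     (\<integral>x. D e x \<partial>lborel) = 0 \<and>
     (AE x in lborel. ((\<lambda>s. p (x + s *\<^sub>R e) * (u (x + s *\<^sub>R e) * (X (x + s *\<^sub>R e) \<bullet> e)))
        has_field_derivative D e x) (at 0))"
    unfolding good_def by blast
  define F where "F x = indicator ?K x * p x * weight x" for x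
  have pc: "continuous_on UNIV p" by (rule real_polynomial_function_continuous_on[OF p])
  have F: "integrable lborel F"
    unfolding F_def by (rule integrable_mult_weight[OF continuous_integrable_cball[OF pc]])
  define E where "E x = (\<Sum>e\<in>Basis. D e x) + F x" for x
  have DI: "integrable lborel (\<lambda>x. \<Sum>e\<in>Basis. D e x)"
    using D by (intro Bochner_Integration.integrable_sum) auto
  have E: "integrable lborel E" unfolding E_def using DI F by simp
  have "(\<integral>x. E x \<partial>lborel) = (\<integral>x. (\<Sum>e\<in>Basis. D e x) \<partial>lborel) + (\<integral>x. F x \<partial>lborel)"
    unfolding E_def by (rule Bochner_Integration.integral_add[OF DI F])
  also have "(\<integral>x. (\<Sum>e\<in>Basis. D e x) \<partial>lborel) = (\<Sum>e\<in>Basis. \<integral>x. D e x \<partial>lborel)"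
    using D by (intro Bochner_Integration.integral_sum) auto
  also have "\<dots> = 0" using D by simp
  finally have EF: "(\<integral>x. E x \<partial>lborel) = (\<integral>x. F x \<partial>lborel)" by simp
  have "AE x in lborel. \<forall>e\<in>Basis. ((\<lambda>s. u (x + s *\<^sub>R e)) has_field_derivative DU e x) (at 0) \<and>
      ((\<lambda>s. X (x + s *\<^sub>R e) \<bullet> e) has_field_derivative DX e x) (at 0) \<and>
      ((\<lambda>s. p (x + s *\<^sub>R e) * (u (x + s *\<^sub>R e) * (X (x + s *\<^sub>R e) \<bullet> e)))
        has_field_derivative D e x) (at 0)"
    using DU_deriv DX_deriv D by (intro AE_finite_allI) auto
  with AE_weight_bound have "AE x in lborel. E x = Dp x (X x) * u x"
  proof eventually_elim
    case (elim x)
    have lin: "linear (Dp x)" using Dp[of x] has_derivative_linear by blast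
    have De: "D e x = Dp x e * (u x * (X x \<bullet> e)) + p x * (DU e x * (X x \<bullet> e) + u x * DX e x)"
      if e: "e \<in> Basis" for e
    proof -
      have "((\<lambda>s::real. x + s *\<^sub>R e) has_derivative (\<lambda>s. s *\<^sub>R e)) (at 0)"
        by (auto intro!: derivative_eq_intros)
      moreover have "(p has_derivative Dp x) (at (x + 0 *\<^sub>R e))" using Dp by simp
      ultimately have "((\<lambda>s. p (x + s *\<^sub>R e)) has_derivative (\<lambda>s. Dp x (s *\<^sub>R e))) (at 0)"
        by (rule has_derivative_compose)
      then have pd: "((\<lambda>s. p (x + s *\<^sub>R e)) has_field_derivative Dp x e) (at 0)"
        using lin by (simp add: has_field_derivative_def linear_scale mult_commute_abs)
      have ud: "((\<lambda>s. u (x + s *\<^sub>R e)) has_field_derivative DU e x) (at 0)"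
        and Xd: "((\<lambda>s. X (x + s *\<^sub>R e) \<bullet> e) has_field_derivative DX e x) (at 0)" using elim e by auto
      have "((\<lambda>s. p (x + s *\<^sub>R e) * (u (x + s *\<^sub>R e) * (X (x + s *\<^sub>R e) \<bullet> e))) has_field_derivative
        (Dp x e * (u x * (X x \<bullet> e)) + p x * (DU e x * (X x \<bullet> e) + u x * DX e x))) (at 0)"
        by (rule DERIV_cong[OF DERIV_mult[OF pd DERIV_mult[OF ud Xd]]]) (simp add: algebra_simps)
      then show ?thesis using elim e DERIV_unique by blast
    qed
    have "F x = p x * weight x" using elim by (auto simp: F_def indicator_def)
    moreover have "Dp x (X x) = (\<Sum>e\<in>Basis. (X x \<bullet> e) * Dp x e)"
      using lin by (subst euclidean_representation[symmetric, of "X x"]) (simp add: linear_sum linear_scale)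
    ultimately show ?case
      by (simp add: E_def De weight_def sum.distrib sum_distrib_left sum_distrib_right algebra_simps)
  qed
  then show thesis
    using that[OF _ E] E EF unfolding F_def by auto
qed

text \<open>Orbits have speed at most \<open>M\<close>, so for such \<open>t\<close> they do not
  leave the margin of width 1; \<open>M + 1\<close> avoids division by zero.\<close>

lemma flow_in_cball:
  assumes "\<bar>t\<bar> < min T (1 / (M + 1))" "x \<in> cball 0 R"
  shows "\<phi> t x \<in> cball 0 (R + 1)"
proof -
  have "norm (\<phi> t x - x) \<le> M * \<bar>t\<bar>" using flow_dist assms by auto
  also have "\<dots> \<le> (M + 1) * \<bar>t\<bar>" by (intro mult_right_mono) auto
  also have "\<dots> \<le> 1" using assms M_nonneg by (simp add: field_simps)
  finally show ?thesis using assms norm_triangle_ineq2[of "\<phi> t x" x] by auto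
qed

text \<open>Points of the ball that carries \<open>u\<close> stay in the larger ball, and elsewhere
  \<open>u x\<close> is 0. Hence a polynomial can be made integrable by a cutoff that the quotient
  does not notice.\<close>

lemma cutoff_quotient:
  assumes t: "\<bar>t\<bar> < min T (1 / (M + 1))"
  shows "(indicator (cball 0 (R + 1)) (\<phi> t x) * g (\<phi> t x) - indicator (cball 0 (R + 1)) x * g x) / t * u x
    = (g (\<phi> t x) - g x) / t * u x"
proof (cases "x \<in> cball 0 R")
  case True
  then have "x \<in> cball 0 (R + 1)" by auto
  then show ?thesis using flow_in_cball[OF t True] by simp
qed (simp add: u_support)

lemma mean_quotient_polynomial_tendsto:
  assumes p: "real_polynomial_function p"
  shows "(mean_quotient (\<lambda>x. indicator (cball 0 (R + 1)) x * p x) \<longlongrightarrow>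
    (\<integral>x. indicator (cball 0 (R + 1)) x * p x * weight x \<partial>lborel)) (at 0)"
proof -
  let ?K = "cball 0 (R + 1) :: 'a set"
  have "\<exists>D. (p has_derivative D) (at x)" for x
    using differentiable_at_real_polynomial_function[OF p] by (auto simp: differentiable_def)
  then obtain Dp where Dp: "\<And>x. (p has_derivative Dp x) (at x)" by metis
  obtain E where E: "E \<in> borel_measurable borel" "integrable lborel E"
    "(\<integral>x. E x \<partial>lborel) = (\<integral>x. indicator ?K x * p x * weight x \<partial>lborel)"
    "AE x in lborel. E x = Dp x (X x) * u x"
    using polynomial_integration_by_parts[OF p Dp] by blast
  obtain Cp where Cp: "Cp-lipschitz_on ?K p"
    using real_polynomial_function_lipschitz[OF p, of ?K] by auto
  have Cp0: "0 \<le> Cp" using Cp lipschitz_on_nonneg by blast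
  define \<tau> where "\<tau> = min T (1 / (M + 1))"
  have \<tau>: "0 < \<tau>" using T_pos M_nonneg by (simp add: \<tau>_def)
  have [measurable]: "p \<in> borel_measurable borel"
    by (rule borel_measurable_continuous_onI[OF real_polynomial_function_continuous_on[OF p]])
  have cut: "mean_quotient (\<lambda>x. indicator ?K x * p x) t = mean_quotient p t" if "\<bar>t\<bar> < \<tau>" for t
    unfolding mean_quotient_def
    by (intro Bochner_Integration.integral_cong refl cutoff_quotient) (use that in \<open>simp add: \<tau>_def\<close>)
  have "(mean_quotient p \<longlongrightarrow> (\<integral>x. E x \<partial>lborel)) (at 0)"
    unfolding tendsto_at_iff_sequentially o_def
  proof (intro allI impI)
    fix S :: "nat \<Rightarrow> real"
    assume S: "\<forall>i. S i \<in> UNIV - {0}" and S0: "S \<longlonglongrightarrow> 0"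
    have "eventually (\<lambda>k. dist (S k) 0 < \<tau>) sequentially" using S0 \<tau> by (rule tendstoD)
    then obtain N where N: "\<And>k. N \<le> k \<Longrightarrow> \<bar>S k\<bar> < \<tau>" by (auto simp: eventually_sequentially)
    \<comment> \<open>Dominated convergence works along sequences; dropping the first
      \<open>N\<close> terms makes the domination hold for every index.\<close>
    define s where "s k = S (k + N)" for k
    have s: "\<bar>s k\<bar> < \<tau>" "s k \<noteq> 0" for k using N S by (auto simp: s_def)
    have s0: "filterlim s (at 0) sequentially"
    proof (rule filterlim_atI)
      show "s \<longlonglongrightarrow> 0" unfolding s_def using S0 by (rule LIMSEQ_ignore_initial_segment)
    qed (use s in simp)
    have [measurable]: "\<phi> (s k) \<in> borel_measurable borel" for k
      using s[of k] by (intro flow_measurable) (simp add: \<tau>_def)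
    have "(\<lambda>k. \<integral>x. (p (\<phi> (s k) x) - p x) / s k * u x \<partial>lborel) \<longlonglongrightarrow> (\<integral>x. E x \<partial>lborel)"
    \<comment> \<open>\<open>Cp\<close> bounds the increment of \<open>p\<close> per distance and
      \<open>M\<close> the distance per time.\<close>
    proof (rule integral_dominated_convergence[where w = "\<lambda>x. Cp * M * \<bar>u x\<bar>"])
      have "integrable lborel u"
        by (rule integrable_bounded_support[of u U R]) (use u_bound u_support in auto)
      then show "integrable lborel (\<lambda>x. Cp * M * \<bar>u x\<bar>)" by simp
      show "AE x in lborel. (\<lambda>k. (p (\<phi> (s k) x) - p x) / s k * u x) \<longlonglongrightarrow> E x"
        using E(4)
      proof eventually_elim
        case (elim x)
        \<comment> \<open>Orbits are differentiable at time 0 and \<open>p\<close> is differentiable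
          everywhere, so the chain rule holds at every point; only the identification with
          \<open>E x\<close> is restricted to almost every \<open>x\<close>.\<close>
        have "((\<lambda>s. \<phi> s x) has_derivative (\<lambda>h. h *\<^sub>R X x)) (at 0)"
          using flow_deriv[of 0 x] T_pos by (simp add: has_vector_derivative_def flow_0)
        moreover have "(p has_derivative Dp x) (at (\<phi> 0 x))" using Dp by (simp add: flow_0)
        ultimately have "((\<lambda>s. p (\<phi> s x)) has_derivative (\<lambda>h. Dp x (h *\<^sub>R X x))) (at 0)"
          by (rule has_derivative_compose)
        moreover have "linear (Dp x)" using Dp[of x] has_derivative_linear by blast
        ultimately have "((\<lambda>s. p (\<phi> s x)) has_field_derivative Dp x (X x)) (at 0)"
          by (simp add: has_field_derivative_def linear_scale mult_commute_abs)
        then have "((\<lambda>h. (p (\<phi> h x) - p x) / h) \<longlongrightarrow> Dp x (X x)) (at 0)"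
          by (simp add: DERIV_def flow_0)
        from filterlim_compose[OF this s0] show ?case
          unfolding elim by (intro tendsto_mult_right)
      qed
      show "AE x in lborel. norm ((p (\<phi> (s k) x) - p x) / s k * u x) \<le> Cp * M * \<bar>u x\<bar>" for k
      proof (rule AE_I2)
        fix x
        show "norm ((p (\<phi> (s k) x) - p x) / s k * u x) \<le> Cp * M * \<bar>u x\<bar>"
        proof (cases "x \<in> cball 0 R")
          case True
          have "\<phi> (s k) x \<in> ?K" using flow_in_cball[OF _ True] s by (simp add: \<tau>_def)
          moreover have "x \<in> ?K" using True by auto
          ultimately have "\<bar>p (\<phi> (s k) x) - p x\<bar> \<le> Cp * norm (\<phi> (s k) x - x)"
            using lipschitz_on_normD[OF Cp] by (metis real_norm_def)
          also have "\<dots> \<le> Cp * (M * \<bar>s k\<bar>)"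
            using s[of k] by (intro mult_left_mono flow_dist Cp0) (simp add: \<tau>_def)
          finally have "\<bar>(p (\<phi> (s k) x) - p x) / s k\<bar> \<le> Cp * M" using s[of k] by (simp add: divide_simps mult_ac)
          from mult_right_mono[OF this abs_ge_zero[of "u x"]] show ?thesis by (simp add: abs_mult)
        qed (simp add: u_support)
      qed
    qed (use E in auto)
    then have "(\<lambda>k. mean_quotient p (S (k + N))) \<longlonglongrightarrow> (\<integral>x. E x \<partial>lborel)"
      by (simp add: mean_quotient_def s_def)
    then show "(\<lambda>k. mean_quotient p (S k)) \<longlonglongrightarrow> (\<integral>x. E x \<partial>lborel)" by (rule LIMSEQ_offset)
  qed
  then show ?thesis
    unfolding E(3)
    by (rule Lim_transform_within[OF _ \<tau>]) (simp add: cut)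
qed

lemma integrable_quotient:
  assumes t: "\<bar>t\<bar> < T" and g: "integrable lborel g"
  shows "integrable lborel (\<lambda>x. (g (\<phi> t x) - g x) / t * u x)"
  by (rule integrable_mult_bounded[where U = U])
    (use integrable_flow[OF t g] g u_bound in auto)

lemma mean_quotient_bound:
  assumes t: "\<bar>t\<bar> < T" "DIM('a) * L * \<bar>t\<bar> \<le> 1" "t \<noteq> 0" and g: "integrable lborel g"
  shows "\<bar>mean_quotient g t\<bar> \<le> (2 * DIM('a) * L * U + B * M) * (\<integral>x. \<bar>g x\<bar> \<partial>lborel)"
proof -
  have "mean_quotient g t = (\<integral>x. (g (\<phi> t x) - g x) * u x \<partial>lborel) / t"
    unfolding mean_quotient_def by (subst integral_divide_zero[symmetric]) simp
  then have "\<bar>mean_quotient g t\<bar> = \<bar>\<integral>x. (g (\<phi> t x) - g x) * u x \<partial>lborel\<bar> / \<bar>t\<bar>" by simp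
  also have "\<dots> \<le> (2 * DIM('a) * L * U + B * M) * (\<integral>x. \<bar>g x\<bar> \<partial>lborel)"
    using flow_difference_bound[OF t(1,2) g u_lipschitz u_bound] t(3)
    by (simp add: pos_divide_le_eq mult_ac)
  finally show ?thesis .
qed

theorem mean_quotient_tendsto:
  assumes g: "integrable lborel g"
  shows "(mean_quotient g \<longlongrightarrow> (\<integral>x. g x * weight x \<partial>lborel)) (at 0)"
proof -
  let ?K = "cball 0 (R + 1) :: 'a set"
  define cut where "cut f x = indicator ?K x * f x" for f :: "'a \<Rightarrow> real" and x
  \<comment> \<open>The first summand bounds the quotients and the second the limit functional, both
    relative to the integral of the absolute value; the added 1 makes \<open>C\<close>
    positive.\<close>
  define C where "C = (2 * DIM('a) * L * U + B * M) + DIM('a) * (M * B + U * L) + 1"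
  have C: "0 < C" using L_nonneg U_nonneg B_nonneg M_nonneg unfolding C_def
    by (intro add_nonneg_pos add_nonneg_nonneg mult_nonneg_nonneg) auto
  \<comment> \<open>Three demands on \<open>t\<close>: the flow is under control, the ball of radius
    \<open>R\<close> stays inside the larger ball, and the volume distortion has its linear
    bound.\<close>
  define \<tau> where "\<tau> = min (min T (1 / (M + 1))) (1 / (DIM('a) * L + 1))"
  have DL: "0 < DIM('a) * L + 1" using L_nonneg by (simp add: add_nonneg_pos)
  have \<tau>: "0 < \<tau>" using T_pos M_nonneg DL by (simp add: \<tau>_def)
  have \<tau>D: "\<bar>t\<bar> < T" "\<bar>t\<bar> < min T (1 / (M + 1))" "DIM('a) * L * \<bar>t\<bar> \<le> 1" if "\<bar>t\<bar> < \<tau>" for t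
  proof -
    have "\<bar>t\<bar> < 1 / (DIM('a) * L + 1)" using that by (simp add: \<tau>_def)
    then have "(DIM('a) * L + 1) * \<bar>t\<bar> < 1" using DL by (simp add: field_simps)
    then show "DIM('a) * L * \<bar>t\<bar> \<le> 1" by (simp add: algebra_simps)
  qed (use that in \<open>auto simp: \<tau>_def\<close>)
  have cut_int: "integrable lborel (cut g)"
    unfolding cut_def by (rule integrable_indicator_cball_mult[OF g])
  \<comment> \<open>Polynomials approximate \<open>g\<close> only on the ball, so the limit is first
    taken for \<open>cut g\<close>, split into a small remainder \<open>h\<close> and
    \<open>cut p\<close>. The cutoff is removed afterwards: small \<open>t\<close> do not notice it,
    and \<open>weight\<close> vanishes almost everywhere off the ball of radius
    \<open>R\<close>.\<close>
  have lim: "(mean_quotient (cut g) \<longlongrightarrow> (\<integral>x. cut g x * weight x \<partial>lborel)) (at 0)"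
  proof (rule tendstoI)
    fix e :: real assume e: "0 < e"
    obtain p where p: "real_polynomial_function p" "(\<integral>x. indicator ?K x * \<bar>g x - p x\<bar> \<partial>lborel) < e / (2 * C)"
      using polynomial_L1_dense_on_cball[OF g, of "e / (2 * C)"] e C by auto
    have p_int: "integrable lborel (cut p)"
      unfolding cut_def by (rule continuous_integrable_cball[OF real_polynomial_function_continuous_on[OF p(1)]])
    define h where "h x = cut g x - cut p x" for x
    have h: "integrable lborel h" unfolding h_def using cut_int p_int by simp
    have "\<bar>h x\<bar> = indicator ?K x * \<bar>g x - p x\<bar>" for x
      by (simp add: h_def cut_def right_diff_distrib[symmetric] abs_mult)
    then have h_small: "(\<integral>x. \<bar>h x\<bar> \<partial>lborel) < e / (2 * C)" using p(2) by simp
    have "eventually (\<lambda>t. dist (mean_quotient (cut p) t) (\<integral>x. cut p x * weight x \<partial>lborel) < e/2) (at 0)"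
      using mean_quotient_polynomial_tendsto[OF p(1)] e unfolding cut_def by (intro tendstoD) auto
    moreover have "eventually (\<lambda>t. \<bar>t\<bar> < \<tau>) (at 0)"
      unfolding eventually_at using \<tau> by (auto simp: dist_real_def)
    moreover have "eventually (\<lambda>t. t \<noteq> 0) (at (0::real))" by (simp add: eventually_at_filter)
    ultimately show "eventually (\<lambda>t. dist (mean_quotient (cut g) t) (\<integral>x. cut g x * weight x \<partial>lborel) < e) (at 0)"
    proof eventually_elim
      case (elim t)
      have "mean_quotient (cut g) t
          = (\<integral>x. (h (\<phi> t x) - h x) / t * u x + (cut p (\<phi> t x) - cut p x) / t * u x \<partial>lborel)"
        unfolding mean_quotient_def h_def by (intro Bochner_Integration.integral_cong) (auto simp: algebra_simps diff_divide_distrib add_divide_distrib)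
      also have "\<dots> = mean_quotient h t + mean_quotient (cut p) t"
        unfolding mean_quotient_def using integrable_quotient[OF \<tau>D(1)[OF elim(2)]] h p_int by simp
      finally have 1: "mean_quotient (cut g) t = mean_quotient h t + mean_quotient (cut p) t" .
      have "(\<integral>x. cut g x * weight x \<partial>lborel) = (\<integral>x. h x * weight x + cut p x * weight x \<partial>lborel)"
        by (simp add: h_def algebra_simps)
      also have "\<dots> = (\<integral>x. h x * weight x \<partial>lborel) + (\<integral>x. cut p x * weight x \<partial>lborel)"
        by (intro Bochner_Integration.integral_add integrable_mult_weight h p_int)
      finally have 2: "(\<integral>x. cut g x * weight x \<partial>lborel)
        = (\<integral>x. h x * weight x \<partial>lborel) + (\<integral>x. cut p x * weight x \<partial>lborel)" .
      have "\<bar>mean_quotient h t\<bar> + \<bar>\<integral>x. h x * weight x \<partial>lborel\<bar> \<le> (C - 1) * (\<integral>x. \<bar>h x\<bar> \<partial>lborel)"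
        using mean_quotient_bound[OF \<tau>D(1,3)[OF elim(2)] elim(3) h] integral_mult_weight_le[OF h]
        by (simp add: C_def algebra_simps)
      also have "\<dots> \<le> C * (\<integral>x. \<bar>h x\<bar> \<partial>lborel)" by (intro mult_right_mono) auto
      also have "\<dots> < e/2" using mult_strict_left_mono[OF h_small C] C by simp
      finally show ?case using elim(1) unfolding 1 2 dist_real_def by linarith
    qed
  qed
  have "(mean_quotient g \<longlongrightarrow> (\<integral>x. cut g x * weight x \<partial>lborel)) (at 0)"
  proof (rule Lim_transform_within[OF lim \<tau>])
    fix t :: real assume "dist t 0 < \<tau>"
    then show "mean_quotient (cut g) t = mean_quotient g t"
      unfolding mean_quotient_def cut_def
      by (intro Bochner_Integration.integral_cong refl cutoff_quotient \<tau>D(2)) simp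
  qed
  also have "(\<integral>x. cut g x * weight x \<partial>lborel) = (\<integral>x. g x * weight x \<partial>lborel)"
  proof (rule integral_cong_AE)
    show "AE x in lborel. cut g x * weight x = g x * weight x"
      using AE_weight_bound by eventually_elim (auto simp: cut_def indicator_def)
  qed (use cut_int g in auto)
  finally show ?thesis .
qed

end

subsection \<open>Localisation\<close>

text \<open>Integrands built from \<open>f\<close>, the flow and \<open>deriv\<close> are matched
  with Borel functions only almost everywhere; completeness of Lebesgue measure then makes them
  measurable.\<close>

lemma lebesgue_integral_AE_borel:
  fixes h k :: "'a::euclidean_space \<Rightarrow> real"
  assumes h: "integrable lborel h" and eq: "AE x in lborel. k x = h x"
  shows "integrable lebesgue k" and "(\<integral>x. k x \<partial>lebesgue) = (\<integral>x. h x \<partial>lborel)"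
proof -
  have hb: "h \<in> borel_measurable lborel" using h by auto
  have eq': "AE x in lebesgue. k x = h x" using eq by (rule AE_completion)
  have kb: "k \<in> borel_measurable lebesgue"
  proof (rule measurableI)
    fix A :: "real set" assume A: "A \<in> sets borel"
    obtain N where N: "{x. k x \<noteq> h x} \<subseteq> N" "N \<in> null_sets lborel"
      using eq unfolding eventually_ae_filter by auto
    have "k -` A = (h -` A - N) \<union> (k -` A \<inter> N)" using N(1) by auto
    moreover have "h -` A - N \<in> sets lborel"
      using measurable_sets[OF hb A] N(2) by auto
    ultimately show "k -` A \<inter> space lebesgue \<in> sets lebesgue"
      by (intro sets_completionI[of _ "h -` A - N" "k -` A \<inter> N" N]) (use N(2) in auto)
  qed simp
  have hl: "h \<in> borel_measurable lebesgue" using hb by (rule measurable_completion)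
  have "integrable lebesgue h" using h hb by (simp add: integrable_completion)
  then show "integrable lebesgue k" using integrable_cong_AE[OF kb hl eq'] by simp
  show "(\<integral>x. k x \<partial>lebesgue) = (\<integral>x. h x \<partial>lborel)"
    using integral_cong_AE[OF kb hl eq'] hb by (simp add: integral_completion)
qed

lemma locally_lipschitz_field_compact:
  assumes X: "locally_lipschitz_field \<Omega> X" and K: "compact K" "K \<subseteq> \<Omega>"
  obtains L where "L-lipschitz_on K X"
proof -
  \<comment> \<open>\<open>local_lipschitz\<close> concerns time-dependent fields, and a uniform
    constant requires a compact set of times; as the field does not depend on time, one instant
    suffices.\<close>
  have "local_lipschitz {0::real} K (\<lambda>_. X)"
    by (rule local_lipschitz_subset[OF X[unfolded locally_lipschitz_field_def] subset_UNIV K(2)])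
  from local_lipschitz_compact_implies_lipschitz[OF this K(1), of thesis] that show thesis by auto
qed

section \<open>Uniqueness and maximality of integral curves\<close>

text \<open>Over the segment from 0 to \<open>t\<close> both curves sweep out a compact subset of
  \<Omega>, on which \<open>X\<close> has one Lipschitz constant; the distance estimate then starts
  from distance 0.\<close>

lemma integral_curve_unique:
  assumes X: "locally_lipschitz_field \<Omega> X"
    and \<gamma>: "integral_curve \<Omega> X x I \<gamma>" and \<eta>: "integral_curve \<Omega> X x J \<eta>"
    and t: "t \<in> I" "t \<in> J"
  shows "\<gamma> t = \<eta> t"
proof -
  have seg: "closed_segment 0 t \<subseteq> I" "closed_segment 0 t \<subseteq> J"
    using \<gamma> \<eta> t by (auto simp: integral_curve_def is_interval_convex_1 convex_contains_segment)
  have cont: "continuous_on (closed_segment 0 t) \<gamma>" "continuous_on (closed_segment 0 t) \<eta>"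
    using \<gamma> \<eta> seg
    by (auto simp: integral_curve_def intro!: continuous_at_imp_continuous_on has_vector_derivative_continuous)
  define S where "S = \<gamma> ` closed_segment 0 t \<union> \<eta> ` closed_segment 0 t"
  have "compact S" unfolding S_def using cont by (intro compact_Un compact_continuous_image) auto
  moreover have "S \<subseteq> \<Omega>" using \<gamma> \<eta> seg by (auto simp: S_def integral_curve_def)
  ultimately obtain L where L: "L-lipschitz_on S X" using locally_lipschitz_field_compact[OF X] by blast
  have "dist (\<gamma> t) (\<eta> t) \<le> exp (L * \<bar>t\<bar>) * dist (\<gamma> 0) (\<eta> 0)"
    by (rule solution_dist_le_abs[OF L]) (use \<gamma> \<eta> seg in \<open>auto simp: S_def integral_curve_def\<close>)
  moreover have "\<gamma> 0 = \<eta> 0" using \<gamma> \<eta> by (simp add: integral_curve_def)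
  ultimately show ?thesis by simp
qed

text \<open>By uniqueness all integral curves through \<open>x\<close> can be glued on the union of
  their intervals, which is connected as every interval contains 0. Maximality is then automatic,
  since an extension would live on one of these intervals. The curve \<open>\<eta>0\<close> makes
  the family nonempty.\<close>

lemma maximal_integral_curve_exists:
  assumes X: "locally_lipschitz_field \<Omega> X" and J0: "integral_curve \<Omega> X x J0 \<eta>0"
  obtains \<gamma> where "maximal_integral_curve \<Omega> X x (\<Union>{J. \<exists>\<eta>. integral_curve \<Omega> X x J \<eta>}) \<gamma>"
proof -
  define I where "I = \<Union>{J. \<exists>\<eta>. integral_curve \<Omega> X x J \<eta>}"
  define \<gamma> where "\<gamma> t = (SOME y. \<exists>J \<eta>. integral_curve \<Omega> X x J \<eta> \<and> t \<in> J \<and> \<eta> t = y)" for t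
  have \<gamma>: "\<gamma> t = \<eta> t" if "integral_curve \<Omega> X x J \<eta>" "t \<in> J" for t J \<eta>
  proof -
    have "\<exists>J \<eta>'. integral_curve \<Omega> X x J \<eta>' \<and> t \<in> J \<and> \<eta>' t = \<gamma> t"
      unfolding \<gamma>_def by (rule someI_ex) (use that in blast)
    then show ?thesis using integral_curve_unique[OF X _ that(1) _ that(2)] by metis
  qed
  have "integral_curve \<Omega> X x I \<gamma>"
    unfolding integral_curve_def
  proof (intro conjI ballI)
    show "open I" by (auto simp: I_def integral_curve_def)
    have "connected I" unfolding I_def
      by (rule connected_Union[where ?S = "{J. \<exists>\<eta>. integral_curve \<Omega> X x J \<eta>}"])
        (auto simp: integral_curve_def is_interval_connected_1)
    then show "is_interval I" by (simp add: is_interval_connected_1)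
    show "0 \<in> I" using J0 by (auto simp: I_def integral_curve_def)
    show "\<gamma> 0 = x" using \<gamma>[OF J0, of 0] J0 by (simp add: integral_curve_def)
    fix t assume "t \<in> I"
    then obtain J \<eta> where J: "integral_curve \<Omega> X x J \<eta>" "t \<in> J" by (auto simp: I_def)
    then show "\<gamma> t \<in> \<Omega>" using \<gamma>[OF J] by (auto simp: integral_curve_def)
    have "(\<eta> has_vector_derivative X (\<eta> t)) (at t)" "open J" using J by (auto simp: integral_curve_def)
    then show "(\<gamma> has_vector_derivative X (\<gamma> t)) (at t)"
      using J \<gamma>[OF J] \<gamma>[OF J(1)] by (metis has_vector_derivative_transform_within_open)
  qed
  then have "maximal_integral_curve \<Omega> X x I \<gamma>"
    unfolding maximal_integral_curve_def by (auto simp: I_def)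
  then show thesis using that by (simp add: I_def)
qed

text \<open>By uniqueness the glued curve extends the given one, so maximality of the latter forces
  equal intervals.\<close>

lemma maximal_integral_curve_interval:
  assumes X: "locally_lipschitz_field \<Omega> X" and I: "maximal_integral_curve \<Omega> X x I \<gamma>"
  shows "I = \<Union>{J. \<exists>\<eta>. integral_curve \<Omega> X x J \<eta>}"
proof -
  have ic: "integral_curve \<Omega> X x I \<gamma>" using I by (simp add: maximal_integral_curve_def)
  obtain \<eta> where \<eta>: "maximal_integral_curve \<Omega> X x (\<Union>{J. \<exists>\<eta>. integral_curve \<Omega> X x J \<eta>}) \<eta>"
    using maximal_integral_curve_exists[OF X ic] by blast
  have sub: "I \<subseteq> \<Union>{J. \<exists>\<eta>. integral_curve \<Omega> X x J \<eta>}" using ic by blast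
  have ic': "integral_curve \<Omega> X x (\<Union>{J. \<exists>\<eta>. integral_curve \<Omega> X x J \<eta>}) \<eta>"
    using \<eta> unfolding maximal_integral_curve_def by (rule conjunct1)
  have agree: "\<forall>t\<in>I. \<eta> t = \<gamma> t"
    by (intro ballI integral_curve_unique[OF X ic' ic] subsetD[OF sub])
  have max: "\<forall>J \<eta>. integral_curve \<Omega> X x J \<eta> \<and> I \<subseteq> J \<and> (\<forall>t\<in>I. \<eta> t = \<gamma> t) \<longrightarrow> J = I"
    using I unfolding maximal_integral_curve_def by (rule conjunct2)
  have "\<Union>{J. \<exists>\<eta>. integral_curve \<Omega> X x J \<eta>} = I"
    by (rule max[rule_format, OF conjI[OF ic' conjI[OF sub agree]]])
  then show ?thesis by (rule sym)
qed

text \<open>This opens up the definite descriptions: any integral curve, however short, computes the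
  flow on its interval.\<close>

lemma flow_eq_integral_curve:
  assumes X: "locally_lipschitz_field \<Omega> X" and \<eta>: "integral_curve \<Omega> X x J \<eta>" and t: "t \<in> J"
  shows "t \<in> flow_interval \<Omega> X x" and "flow \<Omega> X t x = \<eta> t"
proof -
  let ?I = "\<Union>{J. \<exists>\<eta>. integral_curve \<Omega> X x J \<eta>}"
  obtain \<gamma> where \<gamma>: "maximal_integral_curve \<Omega> X x ?I \<gamma>"
    using maximal_integral_curve_exists[OF X \<eta>] by blast
  have "flow_interval \<Omega> X x = ?I"
    unfolding flow_interval_def
    by (rule the_equality) (use \<gamma> maximal_integral_curve_interval[OF X] in blast)+
  then show "t \<in> flow_interval \<Omega> X x" using \<eta> t by auto
  show "flow \<Omega> X t x = \<eta> t"
    unfolding flow_def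
  proof (rule the_equality)
    have "t \<in> ?I" using \<eta> t by auto
    moreover have "\<gamma> t = \<eta> t"
      using \<gamma> \<open>t \<in> ?I\<close> integral_curve_unique[OF X _ \<eta> _ t] unfolding maximal_integral_curve_def by blast
    ultimately show "\<exists>I \<gamma>. maximal_integral_curve \<Omega> X x I \<gamma> \<and> t \<in> I \<and> \<gamma> t = \<eta> t" using \<gamma> by blast
  next
    fix y assume "\<exists>I \<gamma>. maximal_integral_curve \<Omega> X x I \<gamma> \<and> t \<in> I \<and> \<gamma> t = y"
    then show "y = \<eta> t"
      using integral_curve_unique[OF X _ \<eta> _ t] unfolding maximal_integral_curve_def by blast
  qed
qed

section \<open>Passage from \<Omega> to the whole space\<close>

lemma cutoff_field:
  fixes \<Omega> :: "(real^'n) set"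
  assumes \<Omega>: "open \<Omega>" and X: "locally_lipschitz_field \<Omega> X" and K: "compact K" "K \<subseteq> \<Omega>" "K \<noteq> {}"
  obtains Y L M d N where "L-lipschitz_on UNIV Y" "\<And>x. norm (Y x) \<le> M" "0 < d" "compact N" "N \<subseteq> \<Omega>"
    "\<And>x y. x \<in> K \<Longrightarrow> y \<in> ball x d \<Longrightarrow> y \<in> N \<and> Y y = X y"
proof -
  obtain e where e: "0 < e" "(\<Union>x\<in>K. ball x e) \<subseteq> \<Omega>"
    using compact_subset_open_imp_ball_epsilon_subset[OF K(1) \<Omega> K(2)] by blast
  \<comment> \<open>Layers of width \<open>d\<close> around \<open>K\<close>: the cutoff is 1 up to
    distance \<open>d\<close> and 0 from \<open>2 * d\<close> on, and \<open>N\<close> reaches to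
    \<open>3 * d\<close>. This leaves \<open>S\<close> a margin \<open>d\<close> for the zero
    extension and keeps \<open>N\<close> within distance less than \<open>e\<close>, hence in
    \<Omega>.\<close>
  define d where "d = e / 4"
  have d: "0 < d" using e by (simp add: d_def)
  define N where "N = {x. infdist x K \<le> 3 * d}"
  define S where "S = {x. infdist x K \<le> 2 * d}"
  have N: "compact N" unfolding N_def using K d by (intro compact_infdist_le) auto
  have N\<Omega>: "N \<subseteq> \<Omega>"
  proof
    fix x assume x: "x \<in> N"
    obtain y where y: "y \<in> K" "infdist x K = dist x y"
      using infdist_attains_inf[of K x] K compact_imp_closed by blast
    then have "x \<in> ball y e" using x e by (simp add: N_def d_def dist_commute)
    then show "x \<in> \<Omega>" using e y by blast
  qed
  obtain L0 where L0: "L0-lipschitz_on N X" using locally_lipschitz_field_compact[OF X N N\<Omega>] by blast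
  have "bounded (X ` N)"
    by (intro compact_imp_bounded compact_continuous_image lipschitz_on_continuous_on[OF L0] N)
  then obtain M where M: "0 < M" "\<And>x. x \<in> N \<Longrightarrow> norm (X x) \<le> M" unfolding bounded_pos by blast
  define \<kappa> where "\<kappa> x = max 0 (min 1 (2 - infdist x K / d))" for x
  have \<kappa>_bound: "0 \<le> \<kappa> x" "\<kappa> x \<le> 1" for x by (auto simp: \<kappa>_def)
  have \<kappa>_lip: "(1 / d)-lipschitz_on N \<kappa>"
  proof (rule lipschitz_onI)
    fix x y
    have "\<bar>\<kappa> x - \<kappa> y\<bar> \<le> \<bar>infdist x K / d - infdist y K / d\<bar>" by (auto simp: \<kappa>_def)
    also have "\<dots> = \<bar>infdist x K - infdist y K\<bar> / d" using d by (simp add: diff_divide_distrib[symmetric])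
    also have "\<dots> \<le> dist x y / d" using d by (intro divide_right_mono infdist_triangle_abs) auto
    finally show "dist (\<kappa> x) (\<kappa> y) \<le> 1 / d * dist x y" by (simp add: dist_real_def)
  qed (use d in simp)
  define Y where "Y x = \<kappa> x *\<^sub>R X x" for x
  have Y_N: "(1 * L0 + 1 / d * M)-lipschitz_on N Y"
    unfolding Y_def using \<kappa>_bound M by (intro lipschitz_on_mult_bounded[OF \<kappa>_lip _ L0]) auto
  have Y0: "Y x = 0" if "x \<notin> S" for x
  proof -
    have "2 < infdist x K / d" using that d by (simp add: S_def field_simps)
    then show ?thesis by (simp add: Y_def \<kappa>_def)
  qed
  have SN: "S \<subseteq> N" using d by (auto simp: S_def N_def)
  have Y_bound: "norm (Y x) \<le> M" for x
  proof (cases "x \<in> S")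
    case True
    then have "\<kappa> x * norm (X x) \<le> 1 * M" using \<kappa>_bound M SN by (intro mult_mono) auto
    then show ?thesis using \<kappa>_bound by (simp add: Y_def)
  qed (use Y0 M in simp)
  have Y_lip: "(1 * L0 + 1 / d * M + M / d)-lipschitz_on UNIV Y"
  proof (rule lipschitz_on_zero_extension[OF Y_N Y_bound _ _ d Y0])
    show "ball x d \<subseteq> N" if "x \<in> S" for x
    proof
      fix y assume "y \<in> ball x d"
      then show "y \<in> N" using that infdist_triangle[of y K x] by (auto simp: S_def N_def dist_commute)
    qed
  qed (use M in auto)
  have Y_K: "y \<in> N \<and> Y y = X y" if "x \<in> K" "y \<in> ball x d" for x y
  proof -
    have "infdist y K \<le> dist y x" using that by (intro infdist_le) auto
    then have i: "infdist y K \<le> d" using that by (simp add: dist_commute)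
    then have "infdist y K / d \<le> 1" using d by simp
    then have "\<kappa> y = 1" by (simp add: \<kappa>_def)
    then show ?thesis using i d by (simp add: Y_def N_def)
  qed
  show thesis by (rule that[OF Y_lip Y_bound d N N\<Omega> Y_K])
qed

lemma sum_Basis_vec:
  fixes h :: "real^'n \<Rightarrow> 'b::comm_monoid_add"
  shows "(\<Sum>e\<in>Basis. h e) = (\<Sum>i\<in>UNIV. h (axis i 1))"
proof -
  have B: "(Basis :: (real^'n) set) = range (\<lambda>i. axis i 1)" by (auto simp: Basis_vec_def)
  have "inj (\<lambda>i. axis i 1 :: real^'n)" by (auto simp: inj_def axis_eq_axis)
  then show ?thesis unfolding B by (simp add: sum.reindex)
qed

text \<open>\<open>deriv\<close> sees its function only near 0, so agreement on a small ball
  determines the value even if the functions differ elsewhere.\<close>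

lemma partial_deriv_eq:
  assumes "\<And>y. y \<in> ball x d \<Longrightarrow> v y = w y" "0 < d"
    and "((\<lambda>s. w (x + s *\<^sub>R axis i 1)) has_field_derivative D) (at 0)"
  shows "partial_deriv i v x = D"
proof -
  have "eventually (\<lambda>s. s \<in> ball (0::real) d) (nhds 0)" using assms(2) by (intro eventually_nhds_in_open) auto
  then have "eventually (\<lambda>s. v (x + s *\<^sub>R axis i 1) = w (x + s *\<^sub>R axis i 1)) (nhds 0)"
    by eventually_elim (rule assms(1), simp add: dist_norm norm_axis_1)
  then have "((\<lambda>s. v (x + s *\<^sub>R axis i 1)) has_field_derivative D) (at 0)"
    using assms(3) by (subst DERIV_cong_ev[OF refl _ refl]) auto
  then show ?thesis unfolding partial_deriv_def by (rule DERIV_imp_deriv)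
qed

text \<open>The conjuncts besides the limit exclude default values: for small \<open>t\<close> the
  flow is meaningful on the whole support of \<open>u\<close>, and all integrals are those of
  integrable functions.\<close>

theorem proposition3p10:
  fixes \<Omega> :: "(real^'n) set"
    and X :: "real^'n \<Rightarrow> real^'n"
    and f u :: "real^'n \<Rightarrow> real"
  assumes "open \<Omega>"
    and "locally_lipschitz_field \<Omega> X"
    and "locally_integrable_on f \<Omega>"
    and "\<exists>L. L-lipschitz_on \<Omega> u"
    and "compact (supp_in \<Omega> u)"
  shows "(\<forall>\<^sub>F t in at 0. \<forall>x\<in>supp_in \<Omega> u. (t, x) \<in> flow_domain \<Omega> X) \<and>
    (\<forall>\<^sub>F t in at 0. set_integrable lebesgue \<Omega> (\<lambda>x. diff_quotient \<Omega> X t f x * u x)) \<and>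
    set_integrable lebesgue \<Omega> (\<lambda>x. f x * vf_apply X u x) \<and>
    set_integrable lebesgue \<Omega> (\<lambda>x. f x * u x * divergence X x) \<and>
    ((\<lambda>t. LINT x:\<Omega>|lebesgue. diff_quotient \<Omega> X t f x * u x) \<longlongrightarrow>
       - (LINT x:\<Omega>|lebesgue. f x * vf_apply X u x)
       - (LINT x:\<Omega>|lebesgue. f x * u x * divergence X x)) (at 0)"
proof (cases "\<Omega> = {}")
  case True
  then show ?thesis by (simp add: supp_in_def set_integrable_def set_lebesgue_integral_def)
next
  case False
  define K where "K = supp_in \<Omega> u"
  have K: "compact K" "K \<subseteq> \<Omega>" using assms(5) by (auto simp: K_def supp_in_def)
  have u0: "u x = 0" if "x \<in> \<Omega>" "x \<notin> K" for x
    using that closure_subset[of "{x \<in> \<Omega>. u x \<noteq> 0}"] by (auto simp: K_def supp_in_def)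
  \<comment> \<open>\<open>K\<close> is empty if \<open>u\<close> vanishes on \<Omega>, while the
    cutoff is built from distances to a nonempty set; the extra point covers that case.\<close>
  obtain x0 where x0: "x0 \<in> \<Omega>" using False by blast
  obtain Y L M d N where Y: "L-lipschitz_on UNIV Y" "\<And>x. norm (Y x) \<le> M"
    and d: "0 < d" and N: "compact N" "N \<subseteq> \<Omega>"
    and near: "\<And>x y. x \<in> insert x0 K \<Longrightarrow> y \<in> ball x d \<Longrightarrow> y \<in> N \<and> Y y = X y"
    using cutoff_field[OF assms(1,2), of "insert x0 K"] K x0 by (metis compact_insert insert_not_empty insert_subset)
  have ball\<Omega>: "ball x d \<subseteq> \<Omega>" if "x \<in> K" for x using near[of x] N(2) that by blast
  \<comment> \<open>Outside \<Omega> the values of \<open>u\<close> are arbitrary, so they are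
    replaced by 0 before passing to the whole space.\<close>
  define v where "v x = (if x \<in> \<Omega> then u x else 0)" for x
  have v0: "v x = 0" if "x \<notin> K" for x using u0 that by (auto simp: v_def)
  have v_near: "v y = u y" if "x \<in> K" "y \<in> ball x d" for x y
    using ball\<Omega>[OF that(1)] that(2) by (auto simp: v_def)
  obtain C where C: "C-lipschitz_on \<Omega> u" using assms(4) by blast
  have "bounded (u ` K)"
    using K by (intro compact_imp_bounded compact_continuous_image continuous_on_subset[OF lipschitz_on_continuous_on[OF C]])
  then obtain U0 where "\<forall>y\<in>u ` K. \<bar>y\<bar> \<le> U0" unfolding bounded_real by blast
  then have v_bound: "\<bar>v x\<bar> \<le> max U0 0" for x
    using v0[of x] K(2) by (cases "x \<in> K") (auto simp: v_def le_max_iff_disj)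
  have v_lip: "(C + max U0 0 / d)-lipschitz_on UNIV v"
  proof (rule lipschitz_on_zero_extension[where N = \<Omega> and S = K])
    show "C-lipschitz_on \<Omega> v" using C by (rule lipschitz_on_transform) (simp add: v_def)
  qed (use v_bound v0 ball\<Omega> d in auto)
  obtain R where R: "K \<subseteq> cball 0 R" using compact_imp_bounded[OF K(1)] by (auto simp: bounded_iff subset_iff)
  have v_supp: "v x = 0" if "x \<notin> cball 0 R" for x using v0 R that by blast
  obtain T \<phi> where flow: "lipschitz_flow Y L M T \<phi>" using lipschitz_flow_exists[OF Y] by blast
  have "\<forall>e. \<exists>D. D \<in> borel_measurable borel \<and>
      (AE x in lborel. ((\<lambda>s. v (x + s *\<^sub>R e)) has_field_derivative D x) (at 0))"
    by (rule allI, rule lipschitz_borel_directional_derivative[OF v_lip], blast)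
  from choice[OF this] obtain DU where DU: "\<And>e. DU e \<in> borel_measurable borel"
      "\<And>e. AE x in lborel. ((\<lambda>s. v (x + s *\<^sub>R e)) has_field_derivative DU e x) (at 0)" by blast
  have "\<forall>e\<in>Basis. \<exists>D. D \<in> borel_measurable borel \<and>
      (AE x in lborel. ((\<lambda>s. Y (x + s *\<^sub>R e) \<bullet> e) has_field_derivative D x) (at 0))"
  proof
    fix e :: "real^'n" assume "e \<in> Basis"
    note lip = lipschitz_on_inner_Basis[OF Y(1) this]
    show "\<exists>D. D \<in> borel_measurable borel \<and>
      (AE x in lborel. ((\<lambda>s. Y (x + s *\<^sub>R e) \<bullet> e) has_field_derivative D x) (at 0))"
      by (rule lipschitz_borel_directional_derivative[OF lip]) blast
  qed
  from bchoice[OF this] obtain DY where DY: "\<And>e. e \<in> Basis \<Longrightarrow> DY e \<in> borel_measurable borel"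
      "\<And>e. e \<in> Basis \<Longrightarrow> AE x in lborel. ((\<lambda>s. Y (x + s *\<^sub>R e) \<bullet> e) has_field_derivative DY e x) (at 0)"
    by blast
  interpret lipschitz_flow_test Y L M T \<phi> v "C + max U0 0 / d" "max U0 0" R DU DY
    by (intro lipschitz_flow_test.intro flow lipschitz_flow_test_axioms.intro)
      (fact v_lip v_bound v_supp | erule DY | rule DU)+
  \<comment> \<open>Within this time an orbit moves by less than \<open>d\<close>; if it starts in
    \<open>K\<close>, it stays where \<open>Y\<close> and \<open>X\<close> agree.\<close>
  define \<tau> where "\<tau> = min T (d / (M + 1))"
  have \<tau>: "0 < \<tau>" using T_pos d M_nonneg by (simp add: \<tau>_def)
  have flow_ball: "\<phi> t x \<in> ball x d" if "\<bar>t\<bar> < \<tau>" for t x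
  proof -
    have "norm (\<phi> t x - x) \<le> M * \<bar>t\<bar>" using flow_dist that by (simp add: \<tau>_def)
    also have "\<dots> \<le> (M + 1) * \<bar>t\<bar>" by (intro mult_right_mono) auto
    also have "\<dots> < d" using that M_nonneg by (simp add: \<tau>_def field_simps)
    finally show ?thesis by (simp add: dist_norm norm_minus_commute)
  qed
  \<comment> \<open>Such orbits of \<open>Y\<close> are integral curves of \<open>X\<close> inside
    \<Omega>, and therefore compute its flow.\<close>
  have curve: "integral_curve \<Omega> X x {-\<tau><..<\<tau>} (\<lambda>s. \<phi> s x)" if x: "x \<in> K" for x
    unfolding integral_curve_def
  proof (intro conjI ballI)
    fix t assume "t \<in> {-\<tau><..<\<tau>}"
    then have t: "\<bar>t\<bar> < \<tau>" by auto
    then show "\<phi> t x \<in> \<Omega>" using flow_ball ball\<Omega>[OF x] by blast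
    have "Y (\<phi> t x) = X (\<phi> t x)" using near[of x] x flow_ball[OF t] by blast
    then show "((\<lambda>s. \<phi> s x) has_vector_derivative X (\<phi> t x)) (at t)"
      using flow_deriv[of t x] t by (simp add: \<tau>_def)
  qed (use \<tau> flow_0 in \<open>auto simp: is_interval_oo\<close>)
  have flow_X: "t \<in> flow_interval \<Omega> X x" "flow \<Omega> X t x = \<phi> t x" if "x \<in> K" "\<bar>t\<bar> < \<tau>" for t x
    using flow_eq_integral_curve[OF assms(2) curve[OF that(1)], of t] that(2) by (auto simp: abs_less_iff)
  have small: "eventually (\<lambda>t. \<bar>t\<bar> < \<tau>) (at 0)"
    unfolding eventually_at using \<tau> by (auto simp: dist_real_def)
  have domain: "\<forall>\<^sub>F t in at 0. \<forall>x\<in>supp_in \<Omega> u. (t, x) \<in> flow_domain \<Omega> X"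
    using small
  proof eventually_elim
    case (elim t)
    then show ?case using flow_X(1)[OF _ elim] K(2) by (auto simp: K_def[symmetric] flow_domain_def)
  qed
  \<comment> \<open>\<open>N\<close> contains all points within distance \<open>d\<close> of
    \<open>K\<close>, hence every point at which a small-time quotient evaluates \<open>f\<close>
    over the support of \<open>u\<close>.\<close>
  have "integrable lebesgue (\<lambda>x. indicator N x * f x)"
    using assms(3) N by (auto simp: locally_integrable_on_def set_integrable_def)
  then obtain g where g_borel: "g \<in> borel_measurable lborel" and g: "AE x in lborel. indicator N x * f x = g x"
    using completion_ex_borel_measurable_real[OF borel_measurable_integrable] by blast
  have g_int: "integrable lborel g"
  proof -
    have "integrable lebesgue g"
      using \<open>integrable lebesgue (\<lambda>x. indicator N x * f x)\<close> measurable_completion[OF g_borel] AE_completion[OF g]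
      by (rule integrable_cong_AE_imp) 
    then show ?thesis using g_borel by (simp add: integrable_completion)
  qed
  have f_near: "indicator N y * f y = f y" if "x \<in> K" "y \<in> ball x d" for x y
    using near[of x y] that by auto
  \<comment> \<open>For almost every \<open>x\<close>, the cut function agrees with \<open>g\<close>
    both at \<open>x\<close> and at \<open>\<phi> t x\<close>; the second point needs
    \<open>AE_flow\<close>. Off \<open>K\<close> both sides are 0.\<close>
  have quotient: "AE x in lborel. indicator \<Omega> x *\<^sub>R (diff_quotient \<Omega> X t f x * u x) = (g (\<phi> t x) - g x) / t * v x"
    if t: "\<bar>t\<bar> < \<tau>" for t
  proof -
    have "AE x in lborel. indicator N (\<phi> t x) * f (\<phi> t x) = g (\<phi> t x)"
      by (rule AE_flow[OF _ g]) (use t in \<open>simp add: \<tau>_def\<close>)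
    with g show ?thesis
    proof eventually_elim
      case (elim x)
      show ?case
      proof (cases "x \<in> K")
        case True
        have "f x = g x" "f (\<phi> t x) = g (\<phi> t x)"
          using elim f_near[OF True, of x] f_near[OF True flow_ball[OF t]] d by auto
        then show ?thesis using True K(2) flow_X(2)[OF True t] by (auto simp: diff_quotient_def v_def)
      next
        case False
        then show ?thesis using v0[OF False] u0[of x] by (auto simp: indicator_def)
      qed
    qed
  qed
  have quotient_int: "set_integrable lebesgue \<Omega> (\<lambda>x. diff_quotient \<Omega> X t f x * u x)"
    and quotient_eq: "(LINT x:\<Omega>|lebesgue. diff_quotient \<Omega> X t f x * u x) = mean_quotient g t" if t: "\<bar>t\<bar> < \<tau>" for t
  proof -
    have "\<bar>t\<bar> < T" using t by (simp add: \<tau>_def)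
    note * = lebesgue_integral_AE_borel[OF integrable_quotient[OF this g_int] quotient[OF t]]
    show "set_integrable lebesgue \<Omega> (\<lambda>x. diff_quotient \<Omega> X t f x * u x)"
      unfolding set_integrable_def by (rule *(1))
    show "(LINT x:\<Omega>|lebesgue. diff_quotient \<Omega> X t f x * u x) = mean_quotient g t"
      unfolding set_lebesgue_integral_def mean_quotient_def by (rule *(2))
  qed
  define G where "G x = g x * (\<Sum>e\<in>Basis. (Y x \<bullet> e) * DU e x)" for x
  define H where "H x = g x * (v x * (\<Sum>e\<in>Basis. DY e x))" for x
  have G_int: "integrable lborel G" and H_int: "integrable lborel H"
    unfolding G_def H_def using integrable_mult_derivatives[OF g_int] by auto
  have "AE x in lborel. \<forall>e\<in>Basis. ((\<lambda>s. v (x + s *\<^sub>R e)) has_field_derivative DU e x) (at 0) \<and>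
      ((\<lambda>s. Y (x + s *\<^sub>R e) \<bullet> e) has_field_derivative DY e x) (at 0)"
    using DU DY by (intro AE_finite_allI) auto
  with g have GH: "AE x in lborel. indicator \<Omega> x *\<^sub>R (f x * vf_apply X u x) = G x \<and>
      indicator \<Omega> x *\<^sub>R (f x * u x * divergence X x) = H x"
  proof eventually_elim
    case (elim x)
    have axis: "((\<lambda>s. v (x + s *\<^sub>R axis i 1)) has_field_derivative DU (axis i 1) x) (at 0)"
      "((\<lambda>s. Y (x + s *\<^sub>R axis i 1) $ i) has_field_derivative DY (axis i 1) x) (at 0)" for i
      using elim by (auto simp: cart_eq_inner_axis axis_in_Basis_iff)
    show ?case
    proof (cases "x \<in> K")
      case True
      have xd: "x \<in> ball x d" using d by simp
      have "f x = g x" using elim f_near[OF True xd] by simp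
      moreover have "partial_deriv i u x = DU (axis i 1) x" for i
        by (rule partial_deriv_eq[OF _ d axis(1)]) (use v_near[OF True] in auto)
      moreover have "partial_deriv i (\<lambda>y. X y $ i) x = DY (axis i 1) x" for i
        by (rule partial_deriv_eq[OF _ d axis(2)]) (use near[of x] True in auto)
      moreover have "Y x = X x" using near[OF _ xd] True by blast
      ultimately show ?thesis
        using True K(2) v_near[OF True xd]
        by (auto simp: G_def H_def vf_apply_def divergence_def sum_Basis_vec cart_eq_inner_axis)
    next
      case False
      \<comment> \<open>A point of \<Omega> off \<open>K\<close> has a neighbourhood on which
        \<open>u\<close> is 0, so all partial derivatives of \<open>u\<close> vanish there. The
        divergence keeps an unknown value, but its factor \<open>u x\<close> is 0.\<close>
      have DU0: "DU (axis i 1) x = 0" for i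
        by (rule directional_derivative_eq_0[OF compact_imp_closed[OF K(1)] False v0 axis(1)])
      have "vf_apply X u x = 0" if x: "x \<in> \<Omega>"
      proof -
        have "open (\<Omega> - K)" using assms(1) K(1) compact_imp_closed by blast
        then obtain r where r: "0 < r" "ball x r \<subseteq> \<Omega> - K" using x False by (meson DiffI openE)
        have "partial_deriv i u x = 0" for i
          by (rule partial_deriv_eq[where w = "\<lambda>_. 0", OF _ r(1)]) (use r(2) u0 in auto)
        then show ?thesis by (simp add: vf_apply_def)
      qed
      then show ?thesis
        using DU0 v0[OF False] u0[OF _ False]
        by (auto simp: G_def H_def sum_Basis_vec indicator_def)
    qed
  qed
  have G_eq: "AE x in lborel. indicator \<Omega> x *\<^sub>R (f x * vf_apply X u x) = G x"
    and H_eq: "AE x in lborel. indicator \<Omega> x *\<^sub>R (f x * u x * divergence X x) = H x"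
    using GH by (auto elim: eventually_mono)
  note G = lebesgue_integral_AE_borel[OF G_int G_eq] and H = lebesgue_integral_AE_borel[OF H_int H_eq]
  have "(\<integral>x. g x * weight x \<partial>lborel) = (\<integral>x. - G x - H x \<partial>lborel)"
    by (intro Bochner_Integration.integral_cong) (auto simp: weight_def G_def H_def algebra_simps)
  also have "\<dots> = - (\<integral>x. G x \<partial>lborel) - (\<integral>x. H x \<partial>lborel)" using G_int H_int by simp
  also have "\<dots> = - (LINT x:\<Omega>|lebesgue. f x * vf_apply X u x) - (LINT x:\<Omega>|lebesgue. f x * u x * divergence X x)"
    unfolding set_lebesgue_integral_def G(2) H(2) ..
  finally have lim: "(mean_quotient g \<longlongrightarrow>
       - (LINT x:\<Omega>|lebesgue. f x * vf_apply X u x)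
       - (LINT x:\<Omega>|lebesgue. f x * u x * divergence X x)) (at 0)"
    using mean_quotient_tendsto[OF g_int] by simp
  have "((\<lambda>t. LINT x:\<Omega>|lebesgue. diff_quotient \<Omega> X t f x * u x) \<longlongrightarrow>
       - (LINT x:\<Omega>|lebesgue. f x * vf_apply X u x)
       - (LINT x:\<Omega>|lebesgue. f x * u x * divergence X x)) (at 0)"
    by (rule Lim_transform_within[OF lim \<tau>]) (simp add: quotient_eq)
  moreover have "\<forall>\<^sub>F t in at 0. set_integrable lebesgue \<Omega> (\<lambda>x. diff_quotient \<Omega> X t f x * u x)"
    using small by eventually_elim (rule quotient_int)
  moreover have "set_integrable lebesgue \<Omega> (\<lambda>x. f x * vf_apply X u x)"
    "set_integrable lebesgue \<Omega> (\<lambda>x. f x * u x * divergence X x)"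
    unfolding set_integrable_def using G(1) H(1) by auto
  ultimately show ?thesis using domain by blast
qed

end
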